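(* Let $\mathbf{X}_{[1,\infty)}=\{X_n:n\geq 1\}$ be a non-deterministic infinite exchangeable sequence of $\{0,1\}$-valued random variables. Then the following two assertions are equivalent: (1) $\mathbf{X}_{[1,\infty)}$ is Hoeffding decomposable; (2) $\mathbf{X}_{[1,\infty)}$ is either an i.i.d. sequence or a P\'olya sequence.
   Context: Let $\mathbf{X}_{[1,\infty)}=\{X_n:n\ge 1\}$ be an infinite exchangeable sequence of $\{0,1\}$-valued random variables on a probability space $(\Omega,\mathcal F,\mathbb P)$ with $\mathcal F=\sigma(\mathbf{X}_{[1,\infty)})$. By de Finetti's theorem there is a unique probability measure $\gamma$ on $[0,1]$ (the de Finetti measure of the sequence) such that for all $n\ge1$ and $(j_1,\dots,j_n)\in\{0,1\}^n$, $$\mathbb P\{X_1=j_1,\dots,X_n=j_n\}=\int_{[0,1]}\theta^{\sum_k j_k}(1-\theta)^{n-\sum_k j_k}\,\gamma(\mathrm d\theta).$$ The sequence is called non-deterministic if the support of $\gamma$ is not contained in $\{0\}\cup\{1\}$. P\'olya sequence: $\mathbf{X}_{[1,\infty)}$ is a P\'olya sequence (of parameters $\alpha,\beta$) if there exist real numbers $\alpha,\beta>0$ such that $\gamma(\mathrm d\theta)=\frac{1}{B(\alpha,\beta)}\theta^{\alpha-1}(1-\theta)^{\beta-1}\mathrm d\theta$ on $[0,1]$, where $B(\alpha,\beta)=\int_0^1\theta^{\alpha-1}(1-\theta)^{\beta-1}\mathrm d\theta$. Hoeffding decomposability: write $\mathbf{X}_{[n]}=(X_1,\dots,X_n)$ and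 $\mathbf{X}_{[2,k]}=(X_2,\dots,X_k)$ (for $k=1$ conditioning on $\mathbf{X}_{[2,k]}$ means taking the plain expectation). For $n\ge 2$, let $L_s(\mathbf{X}_{[n]})$ be the Hilbert space of random variables $T(X_1,\dots,X_n)$ with $T:\{0,1\}^n\to\mathbb R$ symmetric, with inner product $\langle T_1,T_2\rangle=\mathbb E[T_1(\mathbf{X}_{[n]})T_2(\mathbf{X}_{[n]})]$. Set $SU_0(\mathbf{X}_{[n]})=\mathbb R$ and, for $k=1,\dots,n$, let $SU_k(\mathbf{X}_{[n]})$ be the space of all random variables of the form $$F(\mathbf{X}_{[n]})=\sum_{1\le j_1<\dots<j_k\le n}\varphi(X_{j_1},\dots,X_{j_k}),\qquad \varphi:\{0,1\}^k\to\mathbb R \text{ symmetric}$$ (the kernel $\varphi$ is unique in the sense that two symmetric kernels representing the same $F$ agree a.s. when evaluated at $\mathbf{X}_{[k]}$). For $k=1,\dots,n$ let $SH_k(\mathbf{X}_{[n]})=SU_k(\mathbf{X}_{[n]})\cap SU_{k-1}(\mathbf{X}_{[n]})^{\perp}$, the orthogonal being taken in $L_s(\mathbf{X}_{[n]})$. The sequence $\mathbf{X}_{[1,\infty)}$ is Hoeffding decomposable if for every $n\ge2$ and every $k=1,\dots,n$: a random variable $F=\sum_{1\le j_1<\dots<j_k\le n}\varphi(X_{j_1},\dots,X_{j_k})\in SU_k(\mathbf{X}_{[n]})$, with symmetric kernel $\varphi:\{0,1\}^k\to\mathbb R$, belongs to $SH_k(\mathbf{X}_{[n]})$ if, and only if,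 $\mathbb E[\varphi(\mathbf{X}_{[k]})\mid \mathbf{X}_{[2,k]}]=0$ a.s.-$\mathbb P$. *)

theory Defs
  imports "HOL-Probability.Probability"
begin

text \<open>
  A sequence \<open>X\<^sub>1, X\<^sub>2, \<dots>\<close> of \<open>{0,1}\<close>-valued random variables is a function
  \<open>X :: nat \<Rightarrow> 'a \<Rightarrow> nat\<close> of which only the values at indices \<open>n \<ge> 1\<close> are used.
  Measurability into \<open>bin\<close> includes that the values lie in \<open>{0,1}\<close>.
\<close>

abbreviation bin :: "nat measure" where
  "bin \<equiv> count_space {0, 1}"

definition generated_algebra :: "'a measure \<Rightarrow> (nat \<Rightarrow> 'a \<Rightarrow> nat) \<Rightarrow> nat set \<Rightarrow> 'a measure" where
  "generated_algebra M X I = vimage_algebra (space M) (\<lambda>\<omega>. \<lambda>i\<in>I. X i \<omega>) (\<Pi>\<^sub>M i\<in>I. bin)"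

definition exchangeable :: "'a measure \<Rightarrow> (nat \<Rightarrow> 'a \<Rightarrow> nat) \<Rightarrow> bool" where
  "exchangeable M X \<longleftrightarrow>
     (\<forall>n\<ge>1. \<forall>p. p permutes {1..n} \<longrightarrow>
        distr M (\<Pi>\<^sub>M i\<in>{1..n}. bin) (\<lambda>\<omega>. \<lambda>i\<in>{1..n}. X (p i) \<omega>) =
        distr M (\<Pi>\<^sub>M i\<in>{1..n}. bin) (\<lambda>\<omega>. \<lambda>i\<in>{1..n}. X i \<omega>))"


definition is_de_finetti_measure ::
  "'a measure \<Rightarrow> (nat \<Rightarrow> 'a \<Rightarrow> nat) \<Rightarrow> real measure \<Rightarrow> bool" where
  "is_de_finetti_measure M X \<gamma> \<longleftrightarrow>
     prob_space \<gamma> \<and> sets \<gamma> = sets (restrict_space borel {0..1}) \<and>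
     (\<forall>n\<ge>1. \<forall>j\<in>{1..n} \<rightarrow> {0, 1}.
        measure M {\<omega> \<in> space M. \<forall>k\<in>{1..n}. X k \<omega> = j k} =
        (LINT \<theta>|\<gamma>. \<theta> ^ (\<Sum>k=1..n. j k) * (1 - \<theta>) ^ (n - (\<Sum>k=1..n. j k))))"

text \<open>
  For exchangeable sequences, existence and uniqueness of this measure is de Finetti's theorem.
\<close>

definition de_finetti_measure :: "'a measure \<Rightarrow> (nat \<Rightarrow> 'a \<Rightarrow> nat) \<Rightarrow> real measure" where
  "de_finetti_measure M X = (THE \<gamma>. is_de_finetti_measure M X \<gamma>)"

definition measure_support :: "'b::topological_space measure \<Rightarrow> 'b set" where
  "measure_support \<mu> =
     {x \<in> space \<mu>. \<forall>U. open U \<longrightarrow> x \<in> U \<longrightarrow> emeasure \<mu> (U \<inter> space \<mu>) > 0}"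

definition non_deterministic :: "'a measure \<Rightarrow> (nat \<Rightarrow> 'a \<Rightarrow> nat) \<Rightarrow> bool" where
  "non_deterministic M X \<longleftrightarrow> \<not> measure_support (de_finetti_measure M X) \<subseteq> {0} \<union> {1}"

definition iid_sequence :: "'a measure \<Rightarrow> (nat \<Rightarrow> 'a \<Rightarrow> nat) \<Rightarrow> bool" where
  "iid_sequence M X \<longleftrightarrow>
     prob_space.indep_vars M (\<lambda>_. bin) X {1..} \<and>
     (\<forall>n\<ge>1. distr M bin (X n) = distr M bin (X 1))"

text \<open>
  The normalising constant is the library's \<^const>\<open>Beta\<close>, defined through \<^const>\<open>Gamma\<close>;
  it equals Euler's integral by \<open>has_integral_Beta_real\<close>.
\<close>

definition polya_sequence :: "'a measure \<Rightarrow> (nat \<Rightarrow> 'a \<Rightarrow> nat) \<Rightarrow> bool" where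
  "polya_sequence M X \<longleftrightarrow>
     (\<exists>\<alpha> \<beta> :: real. \<alpha> > 0 \<and> \<beta> > 0 \<and>
        de_finetti_measure M X =
        density (restrict_space lborel {0..1})
          (\<lambda>\<theta>. ennreal (1 / Beta \<alpha> \<beta> * \<theta> powr (\<alpha> - 1) * (1 - \<theta>) powr (\<beta> - 1))))"


text \<open>Functions on \<open>{0,1}\<^sup>k\<close> are functions on lists, of which only the values on \<open>cube k\<close> matter.\<close>

definition cube :: "nat \<Rightarrow> nat list set" where
  "cube k = {xs. length xs = k \<and> set xs \<subseteq> {0, 1}}"

definition symmetric_kernel :: "nat \<Rightarrow> (nat list \<Rightarrow> real) \<Rightarrow> bool" where
  "symmetric_kernel k \<phi> \<longleftrightarrow> (\<forall>xs\<in>cube k. \<forall>ys\<in>cube k. mset xs = mset ys \<longrightarrow> \<phi> xs = \<phi> ys)"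

text \<open>Index tuples \<open>j\<^sub>1 < \<dots> < j\<^sub>k\<close> are encoded as the sets \<open>{j\<^sub>1, \<dots>, j\<^sub>k}\<close>.\<close>

definition subvector :: "(nat \<Rightarrow> 'a \<Rightarrow> nat) \<Rightarrow> nat set \<Rightarrow> 'a \<Rightarrow> nat list" where
  "subvector X J \<omega> = map (\<lambda>i. X i \<omega>) (sorted_list_of_set J)"

definition U_statistic ::
  "(nat \<Rightarrow> 'a \<Rightarrow> nat) \<Rightarrow> nat \<Rightarrow> nat \<Rightarrow> (nat list \<Rightarrow> real) \<Rightarrow> 'a \<Rightarrow> real" where
  "U_statistic X n k \<phi> \<omega> = (\<Sum>J | J \<subseteq> {1..n} \<and> card J = k. \<phi> (subvector X J \<omega>))"

text \<open>
  The spaces below consist of random variables, not of classes modulo almost sure equality.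
  Orthogonality only depends on the classes.
\<close>

definition Ls :: "(nat \<Rightarrow> 'a \<Rightarrow> nat) \<Rightarrow> nat \<Rightarrow> ('a \<Rightarrow> real) set" where
  "Ls X n = {(\<lambda>\<omega>. T (subvector X {1..n} \<omega>)) | T. symmetric_kernel n T}"

definition SU :: "(nat \<Rightarrow> 'a \<Rightarrow> nat) \<Rightarrow> nat \<Rightarrow> nat \<Rightarrow> ('a \<Rightarrow> real) set" where
  "SU X n k = {U_statistic X n k \<phi> | \<phi>. symmetric_kernel k \<phi>}"

lemma SU_0: "SU X n 0 = {(\<lambda>_. c) | c. True}"
proof -
  have "{J. J \<subseteq> {1..n} \<and> card J = 0} = {{}}"
    by (auto dest: finite_subset)
  then have U: "U_statistic X n 0 \<phi> = (\<lambda>_. \<phi> [])" for \<phi>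
    by (simp add: fun_eq_iff U_statistic_def subvector_def)
  have "symmetric_kernel 0 \<phi>" for \<phi>
    by (auto simp: symmetric_kernel_def cube_def)
  then show ?thesis
    unfolding SU_def U by auto
qed

definition orthogonal_in_Ls ::
  "'a measure \<Rightarrow> (nat \<Rightarrow> 'a \<Rightarrow> nat) \<Rightarrow> nat \<Rightarrow> ('a \<Rightarrow> real) set \<Rightarrow> ('a \<Rightarrow> real) set" where
  "orthogonal_in_Ls M X n S = {F \<in> Ls X n. \<forall>G\<in>S. (LINT \<omega>|M. F \<omega> * G \<omega>) = 0}"

definition SH :: "'a measure \<Rightarrow> (nat \<Rightarrow> 'a \<Rightarrow> nat) \<Rightarrow> nat \<Rightarrow> nat \<Rightarrow> ('a \<Rightarrow> real) set" where
  "SH M X n k = SU X n k \<inter> orthogonal_in_Ls M X n (SU X n (k - 1))"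

text \<open>
  For \<open>k = 1\<close> the conditioning algebra is generated by no variables at all, hence trivial, and the
  conditional expectation is almost surely the plain expectation.
\<close>

definition hoeffding_decomposable :: "'a measure \<Rightarrow> (nat \<Rightarrow> 'a \<Rightarrow> nat) \<Rightarrow> bool" where
  "hoeffding_decomposable M X \<longleftrightarrow>
     (\<forall>n\<ge>2. \<forall>k\<in>{1..n}. \<forall>\<phi>. symmetric_kernel k \<phi> \<longrightarrow>
        (U_statistic X n k \<phi> \<in> SH M X n k \<longleftrightarrow>
         (AE \<omega> in M. real_cond_exp M (generated_algebra M X {2..k})
                       (\<lambda>\<omega>. \<phi> (subvector X {1..k} \<omega>)) \<omega> = 0)))"

end

theory Submission
  imports Defs
begin

text \<open>
  Let \<open>p(n,j)\<close> be the probability of a prescribed pattern of length \<open>n\<close> with \<open>j\<close> ones; all of them are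
  positive because the sequence is non-deterministic. A symmetric kernel is a function of the number
  of ones, and \<open>E[\<phi>(X\<^sub>1,\<dots>,X\<^sub>k) | X\<^sub>2,\<dots>,X\<^sub>k] = 0\<close> forces \<open>\<phi>(j) = c (-1)\<^sup>j / p(k,j)\<close>. As the space \<open>SH\<^sub>k\<close> is
  one-dimensional as well, Hoeffding decomposability means that the U-statistics with these kernels
  are orthogonal to those of order \<open>k - 1\<close>. For \<open>n = k + 1\<close> the orthogonality relations are
  \<open>j \<Delta>\<^sup>2r(j - 1) + (k - 1 - j) \<Delta>\<^sup>2r(j) = 0\<close>, where \<open>r(j) = p(k+1,j+1) / p(k,j)\<close> is the probability of a
  further one given \<open>j\<close> ones among \<open>k\<close>; hence \<open>r\<close> is affine in \<open>j\<close>. Conversely, if every \<open>r\<close> is affine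
  then \<open>p(k+q,i+v) / p(k,i)\<close> is a polynomial in \<open>i\<close> of degree at most \<open>q\<close>, and orthogonality holds
  because \<open>m\<close>-th differences with \<open>m > q\<close> annihilate it. Finally, the consistency of the numbers \<open>p(n,j)\<close>
  turns the slopes \<open>b\<^sub>k\<close> of the predictions into \<open>1/b\<^sub>k\<^sub>+\<^sub>1 = 1/b\<^sub>k + 1\<close> or \<open>b\<^sub>k = 0\<close>, which gives the moments of a
  Beta law or of a point mass, and a law on \<open>[0,1]\<close> is determined by its moments.
\<close>

subsection \<open>Symmetric kernels as functions of the number of ones\<close>

lemma sum_Pow_insert:
  fixes f :: "'a set \<Rightarrow> real"
  assumes "finite N" "x \<notin> N"
  shows "(\<Sum>B\<in>Pow (insert x N). f B) = (\<Sum>B\<in>Pow N. f B + f (insert x B))"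
proof -
  have "Pow N \<inter> insert x ` Pow N = {}" "inj_on (insert x) (Pow N)"
    using assms by (auto simp: inj_on_def)
  then show ?thesis
    using assms by (simp add: Pow_insert sum.union_disjoint sum.reindex sum.distrib)
qed

lemma sum_Pow_Un_disjoint:
  fixes f :: "'a set \<Rightarrow> real"
  assumes "finite S" "finite T" "S \<inter> T = {}"
  shows "(\<Sum>B\<in>Pow (S \<union> T). f B) = (\<Sum>C\<in>Pow S. \<Sum>D\<in>Pow T. f (C \<union> D))"
proof -
  have "(\<Sum>B\<in>Pow (S \<union> T). f B) = (\<Sum>(C, D)\<in>Pow S \<times> Pow T. f (C \<union> D))"
    by (rule sum.reindex_bij_witness[where i = "\<lambda>(C, D). C \<union> D" and j = "\<lambda>B. (B \<inter> S, B \<inter> T)"])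
       (use assms in \<open>auto simp flip: Int_Un_distrib simp: Int_absorb2\<close>)
  then show ?thesis
    by (simp add: sum.cartesian_product)
qed

lemma sum_Pow_card:
  fixes f :: "nat \<Rightarrow> real"
  assumes "finite N"
  shows "(\<Sum>B\<in>Pow N. f (card B)) = (\<Sum>s\<le>card N. real (card N choose s) * f s)"
proof -
  have "(\<Sum>B\<in>Pow N. f (card B)) = (\<Sum>s\<le>card N. \<Sum>B\<in>{B\<in>Pow N. card B = s}. f (card B))"
    by (rule sum.group[symmetric]) (use assms in \<open>auto intro: card_mono\<close>)
  also have "\<dots> = (\<Sum>s\<le>card N. real (card N choose s) * f s)"
    using n_subsets[OF assms] by (intro sum.cong) auto
  finally show ?thesis .
qed

lemma card_subsets_meeting:
  assumes "finite N" "B \<subseteq> N" "i \<le> k"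
  shows "card {J. J \<subseteq> N \<and> card J = k \<and> card (J \<inter> B) = i} = (card B choose i) * (card (N - B) choose (k - i))"
proof -
  have fB: "finite B" "finite (N - B)"
    using assms finite_subset by auto
  have "bij_betw (\<lambda>(S, T). S \<union> T)
     ({S. S \<subseteq> B \<and> card S = i} \<times> {T. T \<subseteq> N - B \<and> card T = k - i})
     {J. J \<subseteq> N \<and> card J = k \<and> card (J \<inter> B) = i}"
  proof (rule bij_betw_byWitness[where f' = "\<lambda>J. (J \<inter> B, J - B)"], goal_cases)
    case 3
    show ?case
    proof clarsimp
      fix S T assume ST: "S \<subseteq> B" "T \<subseteq> N - B" "card T = k - card S" "i = card S"
      have "card (S \<union> T) = card S + card T"
        using ST fB by (intro card_Un_disjoint) (auto dest: finite_subset)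
      moreover have "(S \<union> T) \<inter> B = S" using ST by auto
      ultimately show "S \<subseteq> N \<and> T \<subseteq> N \<and> card (S \<union> T) = k \<and> card ((S \<union> T) \<inter> B) = card S"
        using ST assms by auto
    qed
  next
    case 4
    show ?case
    proof clarsimp
      fix J assume J: "J \<subseteq> N" "k = card J" "i = card (J \<inter> B)"
      then have "finite J" using assms finite_subset by auto
      then show "J - B \<subseteq> N - B \<and> card (J - B) = card J - card (J \<inter> B)"
        using J by (auto simp: card_Diff_subset_Int)
    qed
  qed auto
  from bij_betw_same_card[OF this] show ?thesis
    using fB by (simp add: card_cartesian_product n_subsets)
qed

section \<open>U-statistics as functions of the number of ones\<close>

definition kernel_sum :: "nat \<Rightarrow> nat \<Rightarrow> (nat \<Rightarrow> real) \<Rightarrow> nat set \<Rightarrow> real" where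
  "kernel_sum n k \<phi> B = (\<Sum>J | J \<subseteq> {1..n} \<and> card J = k. \<phi> (card (J \<inter> B)))"

text \<open>\<open>kernel_sum\<close> depends on \<open>B\<close> only through
  \<open>s = card B\<close>; this is its hypergeometric form, with \<open>i\<close> chosen points
  among the \<open>s\<close> ones and \<open>k - i\<close> among the zeros.\<close>

definition kernel_count :: "nat \<Rightarrow> nat \<Rightarrow> (nat \<Rightarrow> real) \<Rightarrow> nat \<Rightarrow> real" where
  "kernel_count n k \<phi> s = (\<Sum>i\<le>k. real ((s choose i) * ((n - s) choose (k - i))) * \<phi> i)"

lemma kernel_sum_eq_count:
  assumes "B \<subseteq> {1..n}"
  shows "kernel_sum n k \<phi> B = kernel_count n k \<phi> (card B)"
proof -
  have "card (J \<inter> B) \<le> card J" if "J \<subseteq> {1..n}" for J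
    using that finite_subset by (intro card_mono) auto
  then have "kernel_sum n k \<phi> B =
      (\<Sum>i\<le>k. \<Sum>J\<in>{J \<in> {J. J \<subseteq> {1..n} \<and> card J = k}. card (J \<inter> B) = i}. \<phi> (card (J \<inter> B)))"
    unfolding kernel_sum_def by (subst sum.group) auto
  also have "\<dots> = (\<Sum>i\<le>k. real (card {J. J \<subseteq> {1..n} \<and> card J = k \<and> card (J \<inter> B) = i}) * \<phi> i)"
    by (intro sum.cong refl) (simp add: conj_ac)
  also have "\<dots> = kernel_count n k \<phi> (card B)"
  proof -
    have "card ({1..n} - B) = n - card B"
      using assms by (simp add: card_Diff_subset finite_subset)
    then show ?thesis
      unfolding kernel_count_def using assms by (intro sum.cong refl) (simp add: card_subsets_meeting)
  qed
  finally show ?thesis .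
qed

lemma kernel_count_diff: "kernel_count n k (\<lambda>i. f i - c * g i) s = kernel_count n k f s - c * kernel_count n k g s"
  by (simp add: kernel_count_def algebra_simps sum_subtractf sum_distrib_left)

lemma kernel_count_scale: "kernel_count n k (\<lambda>i. c * g i) s = c * kernel_count n k g s"
  by (simp add: kernel_count_def algebra_simps sum_distrib_left)

lemma kernel_count_cong:
  "(\<And>i. i \<le> k \<Longrightarrow> f i = g i) \<Longrightarrow> kernel_count n k f s = kernel_count n k g s"
  by (simp add: kernel_count_def)

text \<open>A \<open>k\<close>-subset of \<open>k + 1\<close> points omits a single point: omitting
  one of the \<open>s\<close> ones leaves \<open>s - 1\<close> ones, omitting a zero leaves
  \<open>s\<close>. The truncated \<open>s - 1\<close> at \<open>s = 0\<close> carries the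
  coefficient 0.\<close>

lemma kernel_count_Suc:
  assumes "s \<le> Suc k"
  shows "kernel_count (Suc k) k \<phi> s = real s * \<phi> (s - 1) + real (Suc k - s) * \<phi> s"
proof -
  let ?t = "\<lambda>i. real ((s choose i) * ((Suc k - s) choose (k - i))) * \<phi> i"
  have "kernel_count (Suc k) k \<phi> s = (\<Sum>i\<in>{s - 1, s} \<inter> {..k}. ?t i)"
    unfolding kernel_count_def
  proof (rule sum.mono_neutral_right)
    show "\<forall>i\<in>{..k} - {s - 1, s} \<inter> {..k}. ?t i = 0"
    proof
      fix i assume "i \<in> {..k} - {s - 1, s} \<inter> {..k}"
      then have "s < i \<or> Suc k - s < k - i"
        using assms by auto
      then show "?t i = 0" by (auto simp: binomial_eq_0)
    qed
  qed auto
  also have "\<dots> = real s * \<phi> (s - 1) + real (Suc k - s) * \<phi> s"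
  proof -
    consider "s = 0" | "s = Suc k" | u where "s = Suc u" "s \<le> k"
      using assms by (cases s) (auto simp: le_Suc_eq)
    then show ?thesis
    proof cases
      case 1
      then show ?thesis by (simp add: binomial_symmetric[of 1])
    next
      case 2
      then have "{s - 1, s} \<inter> {..k} = {k}" by auto
      then show ?thesis using 2 by simp
    next
      case 3
      then have e: "{s - 1, s} \<inter> {..k} = {u, s}" by auto
      have "Suc k - s = k - u" "k - u = Suc (k - s)" using 3 by auto
      then show ?thesis unfolding e using 3 by simp
    qed
  qed
  finally show ?thesis .
qed

lemma binomial_absorb_real: "real (t choose Suc m) * real (Suc m) = real (t choose m) * (real t - real m)"
proof (cases "m \<le> t")
  case True
  have "Suc m * (t choose Suc m) = (t - m) * (t choose m)"
    using binomial_absorption[of m t] binomial_absorb_comp[of t m] by simp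
  then show ?thesis using True
    by (metis mult.commute of_nat_diff of_nat_mult)
next
  case False
  then show ?thesis by (simp add: binomial_eq_0)
qed

text \<open>
  The kernel of order \<open>k + 1\<close> on the left is the sum of \<open>\<psi>\<close> over the \<open>k\<close>-subsets of its arguments.
\<close>

lemma kernel_count_lower_order:
  assumes s: "s \<le> n"
  shows "kernel_count n (Suc k) (\<lambda>i. real (Suc k - i) * \<psi> i + real i * \<psi> (i - 1)) s
    = (real n - real k) * kernel_count n k \<psi> s"
proof -
  let ?t = "n - s"
  have "kernel_count n (Suc k) (\<lambda>i. real (Suc k - i) * \<psi> i + real i * \<psi> (i - 1)) s =
     (\<Sum>i\<le>Suc k. real (s choose i) * (real (?t choose (Suc k - i)) * real (Suc k - i)) * \<psi> i) +
     (\<Sum>i\<le>Suc k. real (s choose i) * real i * real (?t choose (Suc k - i)) * \<psi> (i - 1))"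
    unfolding kernel_count_def sum.distrib[symmetric] by (intro sum.cong refl) (simp add: algebra_simps)
  \<comment> \<open>Absorption turns the factor \<open>Suc k - i\<close> into
    \<open>?t - (k - i)\<close>, and below the factor \<open>i\<close> into \<open>s - i\<close>;
    the two add up to \<open>n - k\<close>, the number of points by which a \<open>k\<close>-subset
    can be enlarged.\<close>
  also have "(\<Sum>i\<le>Suc k. real (s choose i) * (real (?t choose (Suc k - i)) * real (Suc k - i)) * \<psi> i) =
     (\<Sum>i\<le>k. real (s choose i) * (real (?t choose (k - i)) * (real ?t - real (k - i))) * \<psi> i)"
  proof -
    have "real (?t choose (Suc k - i)) * real (Suc k - i) = real (?t choose (k - i)) * (real ?t - real (k - i))"
      if "i \<le> k" for i
      using binomial_absorb_real[of ?t "k - i"] that by (simp only: Suc_diff_le)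
    then show ?thesis
      unfolding sum.atMost_Suc diff_self_eq_0 of_nat_0 mult_zero_right mult_zero_left add_0_right
      by (intro sum.cong refl) (simp only: atMost_iff)
  qed
  also have "(\<Sum>i\<le>Suc k. real (s choose i) * real i * real (?t choose (Suc k - i)) * \<psi> (i - 1)) =
     (\<Sum>i\<le>k. real (s choose i) * (real s - real i) * real (?t choose (k - i)) * \<psi> i)"
    by (subst sum.atMost_Suc_shift) (simp add: binomial_absorb_real del: of_nat_Suc)
  finally show ?thesis
    using s by (simp add: kernel_count_def sum_distrib_left flip: sum.distrib)
      (auto intro!: sum.cong simp: algebra_simps of_nat_diff)
qed

text \<open>The lower-order kernels form a hyperplane in the \<open>k + 2\<close> values of \<xi>,
  cut out by the alternating sum. The first \<open>k + 1\<close> equations are solved one after the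
  other for \<psi>, and the vanishing sum yields the last one.\<close>

lemma alternating_sum_zero_imp_lower_order:
  assumes "(\<Sum>i\<le>Suc k. (-1) ^ i * real (Suc k choose i) * \<xi> i) = (0::real)"
  shows "\<exists>\<psi>. \<forall>i\<le>Suc k. \<xi> i = real (Suc k - i) * \<psi> i + real i * \<psi> (i - 1)"
proof -
  \<comment> \<open>Equation \<open>i\<close> solved for \<open>\<psi> i\<close>. At
    \<open>i = Suc k\<close> the divisor is 0, but there \<psi> is only multiplied by 0.\<close>
  define \<psi> where "\<psi> = rec_nat (\<xi> 0 / real (Suc k))
     (\<lambda>i y. (\<xi> (Suc i) - real (Suc i) * y) / real (Suc k - Suc i))"
  let ?h = "\<lambda>i. real (Suc k - i) * \<psi> i + real i * \<psi> (i - 1)"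
  have h: "\<xi> i = ?h i" if "i \<le> k" for i
  proof (cases i)
    case 0
    then show ?thesis by (simp add: \<psi>_def)
  next
    case (Suc j)
    then have "real (Suc k - Suc j) \<noteq> 0" using that by auto
    then show ?thesis using Suc by (simp add: \<psi>_def)
  qed
  \<comment> \<open>The two contributions cancel after an index shift. So \<open>?h\<close>
    satisfies the relation assumed for \<xi>, and agreement up to \<open>k\<close> extends to
    \<open>Suc k\<close>.\<close>
  have "(\<Sum>i\<le>Suc k. (-1) ^ i * real (Suc k choose i) * ?h i) =
    (\<Sum>i\<le>Suc k. (-1) ^ i * (real (Suc k choose i) * real (Suc k - i)) * \<psi> i) +
    (\<Sum>i\<le>Suc k. (-1) ^ i * (real (Suc k choose i) * real i) * \<psi> (i - 1))"
    unfolding sum.distrib[symmetric] by (intro sum.cong refl) (simp add: algebra_simps)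
  also have "\<dots> = (\<Sum>i\<le>k. (-1) ^ i * (real (Suc k choose i) * real (Suc k - i)) * \<psi> i) +
    (\<Sum>i\<le>k. - ((-1) ^ i) * (real (Suc k choose Suc i) * real (Suc i)) * \<psi> i)"
    by (subst (2) sum.atMost_Suc_shift) simp
  also have "\<dots> = 0"
    unfolding binomial_absorb_real
    by (simp add: Suc_diff_le of_nat_diff algebra_simps flip: sum.distrib)
  finally have "(\<Sum>i\<le>Suc k. (-1) ^ i * real (Suc k choose i) * ?h i) = 0" .
  then have "(-1) ^ Suc k * \<xi> (Suc k) = (-1) ^ Suc k * ?h (Suc k)"
  proof -
    assume "(\<Sum>i\<le>Suc k. (-1) ^ i * real (Suc k choose i) * ?h i) = 0"
    then have "(\<Sum>i\<le>k. (-1) ^ i * real (Suc k choose i) * ?h i) + (-1) ^ Suc k * ?h (Suc k) = 0"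
      unfolding sum.atMost_Suc binomial_n_n of_nat_1 mult_1_right .
    moreover have "(\<Sum>i\<le>k. (-1) ^ i * real (Suc k choose i) * \<xi> i) + (-1) ^ Suc k * \<xi> (Suc k) = 0"
      using assms unfolding sum.atMost_Suc binomial_n_n of_nat_1 mult_1_right .
    moreover have "(\<Sum>i\<le>k. (-1) ^ i * real (Suc k choose i) * \<xi> i) =
        (\<Sum>i\<le>k. (-1) ^ i * real (Suc k choose i) * ?h i)"
      by (intro sum.cong refl) (use h in auto)
    ultimately show ?thesis by linarith
  qed
  then have "\<xi> (Suc k) = ?h (Suc k)" by simp
  with h show ?thesis
    by (metis le_Suc_eq)
qed

text \<open>Sign convention: this is \<open>(-1)^m\<close> times the usual forward difference of
  order \<open>m\<close>, hence the sum of \<open>(-1)^i * (m choose i) * g (u + i)\<close>.\<close>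

primrec fdiff :: "nat \<Rightarrow> (nat \<Rightarrow> real) \<Rightarrow> nat \<Rightarrow> real" where
  "fdiff 0 g u = g u"
| "fdiff (Suc m) g u = fdiff m g u - fdiff m g (Suc u)"

text \<open>Leibniz rule, where an affine factor leaves two terms only. Such a factor therefore
  raises the degree by at most one, if degree at most \<open>q\<close> means that all differences of
  order above \<open>q\<close> vanish.\<close>

lemma fdiff_affine_mult:
  "fdiff m (\<lambda>i. (a + b * real i) * g i) u =
     (a + b * real u) * fdiff m g u - b * real m * fdiff (m - 1) g (Suc u)"
proof (induction m arbitrary: u)
  case (Suc m)
  show ?case
    unfolding fdiff.simps(2) Suc.IH by (cases m) (simp_all add: algebra_simps)
qed simp

text \<open>One more element of \<open>K\<close> means one more difference. In this way the
  alternating signs of a degenerate kernel become a difference operator.\<close>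

lemma sum_Pow_fdiff:
  assumes "finite K"
  shows "(\<Sum>D\<in>Pow K. (-1) ^ card D * g (u + card D)) = fdiff (card K) g u"
  using assms
proof (induction K arbitrary: u)
  case (insert x K)
  have "(\<Sum>D\<in>Pow (insert x K). (-1) ^ card D * g (u + card D)) =
    (\<Sum>D\<in>Pow K. (-1) ^ card D * g (u + card D) - (-1) ^ card D * g (Suc u + card D))"
    unfolding sum_Pow_insert[OF insert.hyps]
    using insert.hyps by (intro sum.cong refl) (auto simp: card_insert_if finite_subset)
  then show ?case
    using insert.IH[of u] insert.IH[of "Suc u"] insert.hyps by (simp add: sum_subtractf)
qed simp

subsection \<open>Degenerate kernels and affine predictions\<close>

text \<open>The algebraic content of an exchangeable binary law: \<open>p k j\<close> is the
  probability of one fixed pattern of length \<open>k\<close> with \<open>j\<close> ones, and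
  \<open>p_rec\<close> appends a zero or a one to it.\<close>

locale binary_weights =
  fixes p :: "nat \<Rightarrow> nat \<Rightarrow> real"
  assumes p_rec: "j \<le> k \<Longrightarrow> p k j = p (Suc k) j + p (Suc k) (Suc j)"
    and p_pos: "j \<le> k \<Longrightarrow> 0 < p k j"
    and p_00: "p 0 0 = 1"
begin

text \<open>The vanishing conditional expectation, multiplied by the probability of the condition:
  with \<open>j\<close> ones among \<open>X_2, ..., X_k\<close>, the two terms belong to
  \<open>X_1 = 0\<close> and \<open>X_1 = 1\<close>.\<close>

definition degenerate :: "nat \<Rightarrow> (nat \<Rightarrow> real) \<Rightarrow> bool" where
  "degenerate k \<phi> \<longleftrightarrow> (\<forall>j<k. \<phi> j * p k j + \<phi> (Suc j) * p k (Suc j) = 0)"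

text \<open>With \<open>B\<close> as the random set of ones, the sum is the expectation of a product
  of two U-statistics.\<close>

definition orth :: "nat \<Rightarrow> nat \<Rightarrow> (nat \<Rightarrow> real) \<Rightarrow> bool" where
  "orth n k \<phi> \<longleftrightarrow>
     (\<forall>\<psi>. (\<Sum>B\<in>Pow {1..n}. p n (card B) * (kernel_sum n k \<phi> B * kernel_sum n (k - 1) \<psi> B)) = 0)"

definition affine_prediction :: bool where
  "affine_prediction \<longleftrightarrow> (\<forall>k. \<exists>a b. \<forall>j\<le>k. p (Suc k) (Suc j) = (a + b * real j) * p k j)"

lemma degenerate_iff: "degenerate k \<phi> \<longleftrightarrow> (\<exists>c. \<forall>j\<le>k. \<phi> j = c * ((-1) ^ j / p k j))"
proof
  assume d: "degenerate k \<phi>"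
  have "\<phi> j = \<phi> 0 * p k 0 * ((-1) ^ j / p k j)" if "j \<le> k" for j
    using that
  proof (induction j)
    case 0
    then show ?case using p_pos[of 0 k] by simp
  next
    case (Suc j)
    have pos: "p k j > 0" "p k (Suc j) > 0" using Suc.prems by (auto intro: p_pos)
    have "\<phi> j = \<phi> 0 * p k 0 * ((-1) ^ j / p k j)" using Suc by simp
    then have "\<phi> j * p k j = \<phi> 0 * p k 0 * (-1) ^ j" using pos by (simp add: eq_divide_eq)
    moreover have "\<phi> j * p k j + \<phi> (Suc j) * p k (Suc j) = 0"
      using d Suc.prems by (simp add: degenerate_def)
    ultimately have "\<phi> (Suc j) * p k (Suc j) = \<phi> 0 * p k 0 * (-1) ^ Suc j" by simp
    then show ?case using pos by (simp add: eq_divide_eq del: power_Suc)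
  qed
  then show "\<exists>c. \<forall>j\<le>k. \<phi> j = c * ((-1) ^ j / p k j)" by blast
next
  assume "\<exists>c. \<forall>j\<le>k. \<phi> j = c * ((-1) ^ j / p k j)"
  then obtain c where c: "\<And>j. j \<le> k \<Longrightarrow> \<phi> j = c * ((-1) ^ j / p k j)" by blast
  show "degenerate k \<phi>" unfolding degenerate_def
  proof (intro allI impI)
    fix j assume "j < k"
    then have "p k j > 0" "p k (Suc j) > 0" by (auto intro: p_pos)
    then show "\<phi> j * p k j + \<phi> (Suc j) * p k (Suc j) = 0"
      using c[of j] c[of "Suc j"] \<open>j < k\<close> by simp
  qed
qed

text \<open>Marginalisation: the coordinates outside \<open>I\<close> are integrated out one at a
  time, each by \<open>p_rec\<close>.\<close>

lemma sum_Pow_marginal: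
  assumes "finite N" "I \<subseteq> N"
  shows "(\<Sum>B\<in>Pow N. p (card N) (card B) * h (B \<inter> I)) = (\<Sum>B\<in>Pow I. p (card I) (card B) * h B)"
proof -
  have "(\<Sum>B\<in>Pow (I \<union> K). p (card (I \<union> K)) (card B) * h (B \<inter> I)) =
      (\<Sum>B\<in>Pow I. p (card I) (card B) * h B)" if "finite K" "I \<inter> K = {}" for K
    using that
  proof (induction K)
    case empty
    have "B \<inter> I = B" if "B \<in> Pow I" for B using that by auto
    then show ?case by simp
  next
    case (insert x K)
    have fI: "finite I" using assms finite_subset by auto
    have x: "x \<notin> I \<union> K" and fin: "finite (I \<union> K)" using insert fI by auto
    have "(\<Sum>B\<in>Pow (insert x (I \<union> K)). p (card (insert x (I \<union> K))) (card B) * h (B \<inter> I)) =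
      (\<Sum>B\<in>Pow (I \<union> K). p (card (I \<union> K)) (card B) * h (B \<inter> I))"
      unfolding sum_Pow_insert[OF fin x]
    proof (intro sum.cong refl)
      fix B assume B: "B \<in> Pow (I \<union> K)"
      then have "card (insert x B) = Suc (card B)" "insert x B \<inter> I = B \<inter> I"
        using x fin by (auto simp: card_insert_if finite_subset)
      moreover have "card B \<le> card (I \<union> K)" using B fin by (auto intro: card_mono)
      ultimately show "p (card (insert x (I \<union> K))) (card B) * h (B \<inter> I) +
          p (card (insert x (I \<union> K))) (card (insert x B)) * h (insert x B \<inter> I) =
          p (card (I \<union> K)) (card B) * h (B \<inter> I)"
        using x fin p_rec[of "card B" "card (I \<union> K)"] by (simp add: algebra_simps)
    qed
    also have "\<dots> = (\<Sum>B\<in>Pow I. p (card I) (card B) * h B)"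
      using insert by auto
    finally show ?case by simp
  qed
  from this[of "N - I"] show ?thesis
    using assms by (simp add: Un_absorb1)
qed

text \<open>Each of the \<open>q\<close> additional coordinates multiplies the weight by a
  prediction or by one minus a prediction, which is affine in \<open>i\<close>. Hence
  \<open>g\<close> is a product of \<open>q\<close> affine factors; its degree is recorded through
  vanishing differences.\<close>

lemma affine_prediction_multistep:
  assumes aff: affine_prediction and "v \<le> q"
  shows "\<exists>g. (\<forall>m>q. \<forall>u. fdiff m g u = 0) \<and> (\<forall>i\<le>k. p (k + q) (i + v) = g i * p k i)"
  using \<open>v \<le> q\<close>
proof (induction q arbitrary: v)
  case 0
  have "fdiff m (\<lambda>_. 1) u = 0" if "m > 0" for m u
    using that
  proof (induction m arbitrary: u)
    case (Suc m)
    then show ?case by (cases m) auto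
  qed simp
  then show ?case using 0 by (intro exI[of _ "\<lambda>_. 1"]) auto
next
  case (Suc q)
  obtain a b where ab: "\<And>j. j \<le> k + q \<Longrightarrow> p (Suc (k + q)) (Suc j) = (a + b * real j) * p (k + q) j"
    using aff unfolding affine_prediction_def by blast
  have step: "\<forall>m>Suc q. \<forall>u. fdiff m (\<lambda>i. (c + d * real i) * g i) u = 0"
    if "\<forall>m>q. \<forall>u. fdiff m g u = 0" for c d g
    using that by (auto simp: fdiff_affine_mult)
  show ?case
  proof (cases "v \<le> q")
    \<comment> \<open>Here the last additional coordinate is a zero; in the other case all of them
      are ones.\<close>
    case True
    then obtain g where g: "\<forall>m>q. \<forall>u. fdiff m g u = 0" "\<And>i. i \<le> k \<Longrightarrow> p (k + q) (i + v) = g i * p k i"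
      using Suc.IH by blast
    have "p (k + Suc q) (i + v) = ((1 - a - b * real v) + (- b) * real i) * g i * p k i" if "i \<le> k" for i
    proof -
      have "i + v \<le> k + q" using that True by auto
      then have "p (k + Suc q) (i + v) = (1 - a - b * real (i + v)) * p (k + q) (i + v)"
        using p_rec[of "i + v" "k + q"] ab[of "i + v"] by (simp add: algebra_simps)
      then show ?thesis using g(2)[OF that] by (simp add: algebra_simps)
    qed
    then show ?thesis using step[OF g(1), of "1 - a - b * real v" "- b"] by blast
  next
    case False
    then obtain w where w: "v = Suc w" "w = q" using Suc.prems by (cases v) auto
    then obtain g where g: "\<forall>m>q. \<forall>u. fdiff m g u = 0" "\<And>i. i \<le> k \<Longrightarrow> p (k + q) (i + w) = g i * p k i"
      using Suc.IH[of w] by blast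
    have "p (k + Suc q) (i + v) = ((a + b * real w) + b * real i) * g i * p k i" if "i \<le> k" for i
      using ab[of "i + w"] that w g(2)[OF that] by (simp add: algebra_simps)
    then show ?thesis using step[OF g(1), of "a + b * real w" b] by blast
  qed
qed

text \<open>Fix the outcome on \<open>A\<close>, so that \<psi> is constant, and sum over the
  outcomes on \<open>J - A\<close>. The denominator of the degenerate kernel cancels and leaves an
  alternating sum of a polynomial of degree at most \<open>card (A - J)\<close>, which vanishes
  because \<open>card A < card J\<close> makes \<open>J - A\<close> larger than
  \<open>A - J\<close>.\<close>

lemma affine_prediction_pair_orth:
  assumes aff: affine_prediction and deg: "degenerate k \<phi>"
    and J: "finite J" "card J = k" and A: "finite A" "card A < k"
  shows "(\<Sum>B\<in>Pow (A \<union> J). p (card (A \<union> J)) (card B) * (\<phi> (card (J \<inter> B)) * \<psi> (card (A \<inter> B)))) = 0"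
proof -
  define q where "q = card (A - J)"
  obtain c where c: "\<And>j. j \<le> k \<Longrightarrow> \<phi> j = c * ((-1) ^ j / p k j)"
    using deg unfolding degenerate_iff by blast
  have card_split: "card (J \<inter> A) + card (J - A) = k" "card (J \<inter> A) + q = card A"
    using J A card_Int_Diff[of J A] card_Int_Diff[of A J] by (auto simp: q_def Int_commute)
  then have less: "q < card (J - A)" using A by linarith
  have cardU: "card (A \<union> J) = k + q"
  proof -
    have "A \<union> J = J \<union> (A - J)" by auto
    then show ?thesis using J A by (simp only: q_def) (subst card_Un_disjoint; auto)
  qed
  have "(\<Sum>D\<in>Pow (J - A). p (k + q) (card (C \<union> D)) *
          (\<phi> (card (J \<inter> (C \<union> D))) * \<psi> (card (A \<inter> (C \<union> D))))) = 0" if C: "C \<in> Pow A" for C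
  proof -
    \<comment> \<open>\<open>C\<close> is the set of ones in \<open>A\<close>: \<open>u\<close> of
      them are seen by \<phi>, and \<open>v\<close> are among the \<open>q\<close> coordinates
      outside \<open>J\<close>.\<close>
    define u where "u = card (J \<inter> C)"
    define v where "v = card (C - J)"
    have finC: "finite C" using C A finite_subset by auto
    have Cuv: "card C = u + v" by (simp add: u_def v_def Int_commute card_Int_Diff finC)
    have "v \<le> q" unfolding v_def q_def using C A by (intro card_mono) auto
    then obtain g where g: "\<forall>m>q. \<forall>u. fdiff m g u = 0" "\<And>i. i \<le> k \<Longrightarrow> p (k + q) (i + v) = g i * p k i"
      using affine_prediction_multistep[OF aff] by blast
    have "p (k + q) (card (C \<union> D)) * (\<phi> (card (J \<inter> (C \<union> D))) * \<psi> (card (A \<inter> (C \<union> D)))) =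
        (c * \<psi> (card C) * (-1) ^ u) * ((-1) ^ card D * g (u + card D))" if D: "D \<in> Pow (J - A)" for D
    proof -
      have finD: "finite D" using D J finite_subset by auto
      have "card (C \<union> D) = card C + card D" using finC finD C D by (intro card_Un_disjoint) auto
      moreover have "card (J \<inter> (C \<union> D)) = u + card D"
      proof -
        have "J \<inter> (C \<union> D) = (J \<inter> C) \<union> D" using D by auto
        then show ?thesis unfolding u_def using finC finD C D by (simp, subst card_Un_disjoint) auto
      qed
      moreover have "A \<inter> (C \<union> D) = C" using C D by auto
      moreover have le: "u + card D \<le> k"
      proof -
        have "u \<le> card (J \<inter> A)" unfolding u_def using C J by (intro card_mono) auto
        moreover have "card D \<le> card (J - A)" using D J by (intro card_mono) auto
        ultimately show ?thesis using card_split by linarith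
      qed
      moreover have "p k (u + card D) > 0" using le by (rule p_pos)
      moreover have "p (k + q) (u + v + card D) = g (u + card D) * p k (u + card D)"
        using g(2)[OF le] by (simp add: ac_simps)
      ultimately show ?thesis using c[OF le] Cuv
        by (simp add: power_add)
    qed
    then have "(\<Sum>D\<in>Pow (J - A). p (k + q) (card (C \<union> D)) *
          (\<phi> (card (J \<inter> (C \<union> D))) * \<psi> (card (A \<inter> (C \<union> D))))) =
       (c * \<psi> (card C) * (-1) ^ u) * (\<Sum>D\<in>Pow (J - A). (-1) ^ card D * g (u + card D))"
      by (simp add: sum_distrib_left)
    then show ?thesis using J g(1) less by (simp add: sum_Pow_fdiff)
  qed
  then have "(\<Sum>B\<in>Pow (A \<union> (J - A)). p (k + q) (card B) * (\<phi> (card (J \<inter> B)) * \<psi> (card (A \<inter> B)))) = 0"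
    using J A by (subst sum_Pow_Un_disjoint) (auto intro!: sum.neutral)
  then show ?thesis
    unfolding cardU by simp
qed

text \<open>Both U-statistics are expanded into sums over index sets \<open>J\<close> and
  \<open>A\<close>. One product involves the coordinates in \<open>A \<union> J\<close> only, so
  \<open>sum_Pow_marginal\<close> reduces its expectation to
  \<open>affine_prediction_pair_orth\<close>.\<close>

lemma affine_prediction_imp_orth:
  assumes aff: affine_prediction and deg: "degenerate k \<phi>" and k: "1 \<le> k"
  shows "orth n k \<phi>"
  unfolding orth_def
proof
  fix \<psi>
  have "(\<Sum>B\<in>Pow {1..n}. p n (card B) * (kernel_sum n k \<phi> B * kernel_sum n (k - 1) \<psi> B)) =
    (\<Sum>B\<in>Pow {1..n}. \<Sum>J | J \<subseteq> {1..n} \<and> card J = k. \<Sum>A | A \<subseteq> {1..n} \<and> card A = k - 1.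
       p n (card B) * (\<phi> (card (J \<inter> B)) * \<psi> (card (A \<inter> B))))"
  proof (intro sum.cong refl)
    fix B
    show "p n (card B) * (kernel_sum n k \<phi> B * kernel_sum n (k - 1) \<psi> B) =
      (\<Sum>J | J \<subseteq> {1..n} \<and> card J = k. \<Sum>A | A \<subseteq> {1..n} \<and> card A = k - 1.
       p n (card B) * (\<phi> (card (J \<inter> B)) * \<psi> (card (A \<inter> B))))"
      unfolding kernel_sum_def by (subst sum_product) (simp only: sum_distrib_left)
  qed
  also have "\<dots> = (\<Sum>J | J \<subseteq> {1..n} \<and> card J = k. \<Sum>A | A \<subseteq> {1..n} \<and> card A = k - 1. \<Sum>B\<in>Pow {1..n}.
       p n (card B) * (\<phi> (card (J \<inter> B)) * \<psi> (card (A \<inter> B))))"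
    by (subst sum.swap, rule sum.cong[OF refl], rule sum.swap)
  also have "\<dots> = 0"
  proof (rule sum.neutral, rule ballI, rule sum.neutral, rule ballI)
    fix J A assume J: "J \<in> {J. J \<subseteq> {1..n} \<and> card J = k}" and A: "A \<in> {A. A \<subseteq> {1..n} \<and> card A = k - 1}"
    have fin: "finite J" "finite A" using J A finite_subset by auto
    have "(\<Sum>B\<in>Pow {1..n}. p n (card B) * (\<phi> (card (J \<inter> B)) * \<psi> (card (A \<inter> B)))) =
      (\<Sum>B\<in>Pow {1..n}. p (card {1..n}) (card B) *
         (\<phi> (card (J \<inter> (B \<inter> (A \<union> J)))) * \<psi> (card (A \<inter> (B \<inter> (A \<union> J))))))"
    proof (intro sum.cong refl)
      fix B
      have "J \<inter> (B \<inter> (A \<union> J)) = J \<inter> B" "A \<inter> (B \<inter> (A \<union> J)) = A \<inter> B" by auto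
      then show "p n (card B) * (\<phi> (card (J \<inter> B)) * \<psi> (card (A \<inter> B))) = p (card {1..n}) (card B) *
         (\<phi> (card (J \<inter> (B \<inter> (A \<union> J)))) * \<psi> (card (A \<inter> (B \<inter> (A \<union> J)))))" by simp
    qed
    also have "\<dots> = (\<Sum>B\<in>Pow (A \<union> J). p (card (A \<union> J)) (card B) * (\<phi> (card (J \<inter> B)) * \<psi> (card (A \<inter> B))))"
      using J A by (intro sum_Pow_marginal) auto
    also have "\<dots> = 0"
      using affine_prediction_pair_orth[OF aff deg fin(1) _ fin(2)] J A k by auto
    finally show "(\<Sum>B\<in>Pow {1..n}. p n (card B) * (\<phi> (card (J \<inter> B)) * \<psi> (card (A \<inter> B)))) = 0" .
  qed
  finally show "(\<Sum>B\<in>Pow {1..n}. p n (card B) * (kernel_sum n k \<phi> B * kernel_sum n (k - 1) \<psi> B)) = 0" .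
qed

section \<open>From orthogonality to degenerate kernels and affine predictions\<close>

lemma orth_iff_kernel_count:
  "orth n k \<phi> \<longleftrightarrow>
    (\<forall>\<psi>. (\<Sum>s\<le>n. real (n choose s) * (p n s * (kernel_count n k \<phi> s * kernel_count n (k - 1) \<psi> s))) = 0)"
proof -
  have "(\<Sum>B\<in>Pow {1..n}. p n (card B) * (kernel_sum n k \<phi> B * kernel_sum n (k - 1) \<psi> B)) =
     (\<Sum>B\<in>Pow {1..n}. p n (card B) * (kernel_count n k \<phi> (card B) * kernel_count n (k - 1) \<psi> (card B)))" for \<psi>
    by (intro sum.cong) (auto simp: kernel_sum_eq_count)
  also have "\<dots> \<psi> = (\<Sum>s\<le>n. real (n choose s) * (p n s * (kernel_count n k \<phi> s * kernel_count n (k - 1) \<psi> s)))" for \<psi>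
    using sum_Pow_card[of "{1..n}" "\<lambda>s. p n s * (kernel_count n k \<phi> s * kernel_count n (k - 1) \<psi> s)"] by simp
  finally show ?thesis
    unfolding orth_def by simp
qed

text \<open>The kernels of order \<open>k\<close> whose U-statistics are given by lower-order
  kernels contain a hyperplane, and the canonical degenerate kernel lies off it. So \<phi> is a
  multiple of that kernel up to a remainder with zero U-statistic, and a kernel with zero
  U-statistic is itself zero.\<close>

lemma orth_imp_degenerate:
  assumes k: "1 \<le> k" "k \<le> n" and orth: "orth n k \<phi>" and orth0: "orth n k (\<lambda>j. (-1) ^ j / p k j)"
  shows "degenerate k \<phi>"
proof -
  obtain l where l: "k = Suc l" using k by (cases k) auto
  define \<phi>0 where "\<phi>0 = (\<lambda>j. (-1) ^ j / p k j)"
  \<comment> \<open>The functional of \<open>alternating_sum_zero_imp_lower_order\<close>. On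
    \<open>\<phi>0\<close> the signs cancel, hence the positive value below.\<close>
  define T where "T = (\<lambda>\<xi>::nat \<Rightarrow> real. \<Sum>i\<le>k. (-1) ^ i * real (k choose i) * \<xi> i)"
  have "T \<phi>0 = (\<Sum>i\<le>k. real (k choose i) / p k i)"
    unfolding T_def \<phi>0_def by (intro sum.cong refl) (simp add: field_simps flip: power_add mult_2)
  also have "\<dots> > 0"
    by (intro sum_pos) (auto intro!: divide_pos_pos p_pos)
  finally have T0: "T \<phi>0 > 0" .
  \<comment> \<open>This choice of \<open>c\<close> makes \<open>\<phi> - c \<phi>0\<close> a kernel of order \<open>k - 1\<close>, so its U-statistic is orthogonal to itself.\<close>
  define c where "c = T \<phi> / T \<phi>0"
  define \<xi> where "\<xi> = (\<lambda>i. \<phi> i - c * \<phi>0 i)"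
  have "T \<xi> = T \<phi> - c * T \<phi>0"
    by (simp add: T_def \<xi>_def algebra_simps sum_subtractf sum_distrib_left)
  also have "\<dots> = 0" using T0 by (simp add: c_def)
  finally have "T \<xi> = 0" .
  then obtain \<psi> where \<psi>: "\<And>i. i \<le> k \<Longrightarrow> \<xi> i = real (k - i) * \<psi> i + real i * \<psi> (i - 1)"
    using alternating_sum_zero_imp_lower_order[of l \<xi>] unfolding T_def l by blast
  \<comment> \<open>The factor comes from \<open>kernel_count_lower_order\<close>: each
    \<open>l\<close>-subset lies in \<open>n - l\<close> subsets of size \<open>k\<close>.\<close>
  define \<psi>' where "\<psi>' = (\<lambda>i. (real n - real l) * \<psi> i)"
  have low: "kernel_count n k \<xi> s = kernel_count n (k - 1) \<psi>' s" if "s \<le> n" for s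
  proof -
    have "kernel_count n k \<xi> s = kernel_count n (Suc l) (\<lambda>i. real (Suc l - i) * \<psi> i + real i * \<psi> (i - 1)) s"
      unfolding l by (rule kernel_count_cong) (use \<psi> l in blast)
    then show ?thesis
      using kernel_count_lower_order[OF that, of l \<psi>] l unfolding \<psi>'_def by (simp add: kernel_count_scale)
  qed
  have "(\<Sum>s\<le>n. real (n choose s) * (p n s * (kernel_count n k \<xi> s * kernel_count n (k - 1) \<psi>' s))) =
     (\<Sum>s\<le>n. real (n choose s) * (p n s * (kernel_count n k \<phi> s * kernel_count n (k - 1) \<psi>' s))) -
     c * (\<Sum>s\<le>n. real (n choose s) * (p n s * (kernel_count n k \<phi>0 s * kernel_count n (k - 1) \<psi>' s)))"
    by (simp add: \<xi>_def kernel_count_diff algebra_simps sum_subtractf sum_distrib_left)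
  also have "\<dots> = 0"
    using orth orth0 unfolding orth_iff_kernel_count \<phi>0_def by simp
  finally have "(\<Sum>s\<le>n. real (n choose s) * (p n s * (kernel_count n k \<xi> s)\<^sup>2)) = 0"
    using low by (simp add: power2_eq_square cong: sum.cong_simp)
  then have *: "\<forall>s\<in>{..n}. real (n choose s) * (p n s * (kernel_count n k \<xi> s)\<^sup>2) = 0"
    by (subst (asm) sum_nonneg_eq_0_iff) (auto intro!: mult_nonneg_nonneg less_imp_le[OF p_pos])
  then have zero: "kernel_count n k \<xi> s = 0" if "s \<le> n" for s
  proof -
    have "real (n choose s) * (p n s * (kernel_count n k \<xi> s)\<^sup>2) = 0" using * that by blast
    moreover have "real (n choose s) > 0" "p n s > 0" using that p_pos by (auto simp: zero_less_binomial)
    ultimately show ?thesis by simp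
  qed
  \<comment> \<open>The system is triangular: at \<open>s = i\<close> the binomial
    \<open>i choose j\<close> removes \<open>j > i\<close>, the induction removes
    \<open>j < i\<close>, and the remaining coefficient is positive since
    \<open>k \<le> n\<close>.\<close>
  have "\<xi> i = 0" if "i \<le> k" for i
    using that
  proof (induction i rule: less_induct)
    case (less i)
    have "kernel_count n k \<xi> i = (\<Sum>j\<in>{i}. real ((i choose j) * ((n - i) choose (k - j))) * \<xi> j)"
      unfolding kernel_count_def
    proof (rule sum.mono_neutral_right)
      show "\<forall>j\<in>{..k} - {i}. real ((i choose j) * ((n - i) choose (k - j))) * \<xi> j = 0"
      proof
        fix j assume "j \<in> {..k} - {i}"
        then have "i < j \<or> j < i" by auto
        then show "real ((i choose j) * ((n - i) choose (k - j))) * \<xi> j = 0"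
          using less by (auto simp: binomial_eq_0)
      qed
    qed (use less in auto)
    then have "real ((n - i) choose (k - i)) * \<xi> i = 0"
      using zero[of i] less.prems k by simp
    then show ?case using k less.prems by (auto simp: zero_less_binomial)
  qed
  then show ?thesis
    unfolding degenerate_iff by (intro exI[of _ c]) (auto simp: \<xi>_def \<phi>0_def)
qed

text \<open>The test kernels of order \<open>k - 1\<close> are 1 at a single \<open>j\<close>. Since
  \<open>k - 1\<close> of \<open>k + 1\<close> coordinates are sampled, only outcomes with
  \<open>j\<close>, \<open>j + 1\<close> or \<open>j + 2\<close> ones contribute. The resulting
  three-term relation is a vanishing second difference of \<open>e\<close>, and this passes on to
  the predictions \<open>r\<close>.\<close>

lemma orth_imp_affine_step:
  assumes k: "2 \<le> k" and orth: "orth (Suc k) k (\<lambda>j. (-1) ^ j / p k j)"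
  shows "\<exists>a b. \<forall>j\<le>k. p (Suc k) (Suc j) = (a + b * real j) * p k j"
proof -
  define \<phi> where "\<phi> = (\<lambda>j. (-1) ^ j / p k j)"
  define r where "r = (\<lambda>j. p (Suc k) (Suc j) / p k j)"
  \<comment> \<open>Up to sign, \<open>e s\<close> is the U-statistic of the canonical kernel times
    the weight \<open>p (Suc k) s\<close>. The unspecified value \<open>r (Suc k)\<close> occurs
    with coefficient 0 only.\<close>
  define e where "e = (\<lambda>s. real (Suc k - s) * (1 - r s) - real s * r (s - 1))"
  have e: "p (Suc k) s * kernel_count (Suc k) k \<phi> s = (-1) ^ s * e s" if "s \<le> Suc k" for s
  proof -
    have 1: "real (Suc k - s) * (p (Suc k) s * \<phi> s) = (-1) ^ s * (real (Suc k - s) * (1 - r s))"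
    proof (cases "s \<le> k")
      case True
      have "p (Suc k) s * \<phi> s = (-1) ^ s * (1 - r s)"
        using p_rec[OF True] p_pos[OF True] by (simp add: \<phi>_def r_def field_simps)
      then show ?thesis by simp
    next
      case False
      then have "Suc k - s = 0" by simp
      then show ?thesis by simp
    qed
    have 2: "real s * (p (Suc k) s * \<phi> (s - 1)) = - ((-1) ^ s * (real s * r (s - 1)))"
      by (cases s) (simp_all add: \<phi>_def r_def)
    show ?thesis
      unfolding kernel_count_Suc[OF that] e_def using 1 2 by (simp add: algebra_simps)
  qed
  have second: "e j - 2 * e (Suc j) + e (Suc (Suc j)) = 0" if "j \<le> k - 1" for j
  proof -
    have j: "Suc j \<le> k" using that k by linarith
    define m where "m = k - Suc j"
    have mk: "k = m + Suc j" using j by (simp add: m_def)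
    have ind: "kernel_count (Suc k) (k - 1) (\<lambda>i. if i = j then 1 else 0) s =
        real ((s choose j) * ((Suc k - s) choose (k - 1 - j)))" for s
    proof -
      have "kernel_count (Suc k) (k - 1) (\<lambda>i. if i = j then 1 else 0) s =
        (\<Sum>i\<in>{j}. real ((s choose i) * ((Suc k - s) choose (k - 1 - i))))"
        unfolding kernel_count_def using that by (intro sum.mono_neutral_cong_right) auto
      then show ?thesis by simp
    qed
    have "0 = (\<Sum>s\<le>Suc k. real (Suc k choose s) * (p (Suc k) s * (kernel_count (Suc k) k \<phi> s *
         kernel_count (Suc k) (k - 1) (\<lambda>i. if i = j then 1 else 0) s)))"
      using orth unfolding orth_iff_kernel_count \<phi>_def[symmetric] by simp
    also have "\<dots> = (\<Sum>s\<le>Suc k. real (Suc k choose s) * ((-1) ^ s * e s) *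
        real ((s choose j) * ((Suc k - s) choose (k - 1 - j))))"
      unfolding ind
    proof (intro sum.cong refl)
      fix s assume "s \<in> {..Suc k}"
      then have "p (Suc k) s * kernel_count (Suc k) k \<phi> s = (-1) ^ s * e s" using e by simp
      then show "real (Suc k choose s) * (p (Suc k) s * (kernel_count (Suc k) k \<phi> s *
           real ((s choose j) * ((Suc k - s) choose (k - 1 - j))))) =
         real (Suc k choose s) * ((-1) ^ s * e s) * real ((s choose j) * ((Suc k - s) choose (k - 1 - j)))"
        by (metis mult.assoc)
    qed
    also have "\<dots> = (\<Sum>s\<in>{j, Suc j, Suc (Suc j)}. real (Suc k choose s) * ((-1) ^ s * e s) *
        real ((s choose j) * ((Suc k - s) choose (k - 1 - j))))"
    proof (rule sum.mono_neutral_right)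
      show "\<forall>s\<in>{..Suc k} - {j, Suc j, Suc (Suc j)}. real (Suc k choose s) * ((-1) ^ s * e s) *
        real ((s choose j) * ((Suc k - s) choose (k - 1 - j))) = 0"
      proof
        fix s assume s: "s \<in> {..Suc k} - {j, Suc j, Suc (Suc j)}"
        then have "s < j \<or> Suc (Suc j) < s" by auto
        then have "s < j \<or> Suc k - s < k - 1 - j" using s that k by auto
        then show "real (Suc k choose s) * ((-1) ^ s * e s) *
          real ((s choose j) * ((Suc k - s) choose (k - 1 - j))) = 0"
          by (auto simp: binomial_eq_0)
      qed
    qed (use j in auto)
    also have "\<dots> = (-1) ^ j * (real (Suc k choose j) * real (Suc (Suc m) choose m) * e j
       - real (Suc k choose Suc j) * real (Suc j) * real (Suc m) * e (Suc j)
       + real (Suc k choose Suc (Suc j)) * real (Suc (Suc j) choose j) * e (Suc (Suc j)))"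
      by (simp add: mk algebra_simps del: binomial_Suc_Suc) 
    finally have E: "real (Suc k choose j) * real (Suc (Suc m) choose m) * e j
       - real (Suc k choose Suc j) * real (Suc j) * real (Suc m) * e (Suc j)
       + real (Suc k choose Suc (Suc j)) * real (Suc (Suc j) choose j) * e (Suc (Suc j)) = 0" by simp
    have c2: "real (Suc (Suc i) choose i) = real (Suc i) * real (Suc (Suc i)) / 2" for i
    proof -
      have "Suc (Suc i) choose i = Suc (Suc i) choose Suc (Suc 0)" by (subst binomial_symmetric) auto
      moreover have "real (Suc (Suc i) choose Suc (Suc 0)) = real (Suc i) * real (Suc (Suc i)) / 2"
        by (induction i) (simp_all add: field_simps)
      ultimately show ?thesis by simp
    qed
    \<comment> \<open>The coefficients in \<open>E\<close> are in the ratio 1 : 2 : 1, with common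
      factor \<open>b * Suc m * Suc (Suc m) / 2\<close>; this makes \<open>E\<close> a second
      difference.\<close>
    define b where "b = real (Suc k choose j)"
    have b0: "b > 0" using j by (simp add: b_def zero_less_binomial del: binomial_Suc_Suc)
    have b1: "real (Suc k choose Suc j) * real (Suc j) = b * real (Suc (Suc m))"
      unfolding binomial_absorb_real b_def using mk by simp
    have b2: "real (Suc k choose Suc (Suc j)) * real (Suc (Suc j)) = real (Suc k choose Suc j) * real (Suc m)"
      unfolding binomial_absorb_real using mk by simp
    have b3: "real (Suc k choose Suc (Suc j)) * real (Suc (Suc j) choose j) =
        b * real (Suc m) * real (Suc (Suc m)) / 2"
    proof -
      let ?x = "real (Suc k choose Suc (Suc j))" and ?y = "real (Suc k choose Suc j)"
      have "?x * real (Suc (Suc j) choose j) = (?x * real (Suc (Suc j))) * real (Suc j) / 2"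
        unfolding c2 by (simp only: mult_ac times_divide_eq_right times_divide_eq_left)
      also have "\<dots> = (?y * real (Suc j)) * real (Suc m) / 2"
        unfolding b2 by (simp only: mult_ac)
      finally show ?thesis unfolding b1 by (simp only: mult_ac)
    qed
    have "b * real (Suc m) * real (Suc (Suc m)) / 2 * (e j - 2 * e (Suc j) + e (Suc (Suc j))) = 0"
      using E unfolding b1 b3 c2[of m] b_def[symmetric] by (simp add: field_simps)
    then show ?thesis using b0 by (auto simp del: of_nat_Suc)
  qed
  \<comment> \<open>The second difference of \<open>e\<close> at \<open>j\<close> combines those of
    \<open>r\<close> at \<open>j - 1\<close> and at \<open>j\<close>. At \<open>j = 0\<close> only
    the latter is present, which starts the induction.\<close>
  have D: "r j - 2 * r (Suc j) + r (Suc (Suc j)) = 0" if "j \<le> k - 2" for j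
    using that
  proof (induction j)
    case 0
    have "e 0 - 2 * e 1 + e 2 = 0" using second[of 0] k by (simp add: numeral_2_eq_2)
    then have "real (k - 1) * (r 0 - 2 * r 1 + r 2) = 0"
      using k by (simp add: e_def of_nat_diff algebra_simps)
    then show ?case using k by (simp add: numeral_2_eq_2)
  next
    case (Suc j)
    have "e (Suc j) - 2 * e (Suc (Suc j)) + e (Suc (Suc (Suc j))) = 0" using second[of "Suc j"] Suc.prems by simp
    then have "real (k - 2 - j) * (r (Suc j) - 2 * r (Suc (Suc j)) + r (Suc (Suc (Suc j)))) +
      real (Suc j) * (r j - 2 * r (Suc j) + r (Suc (Suc j))) = 0"
      using Suc.prems k by (simp add: e_def of_nat_diff algebra_simps)
    then have "real (k - 2 - j) * (r (Suc j) - 2 * r (Suc (Suc j)) + r (Suc (Suc (Suc j)))) = 0"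
      using Suc by simp
    moreover have "0 < k - 2 - j" using Suc.prems by linarith
    ultimately show ?case by (metis mult_eq_0_iff of_nat_0_less_iff less_irrefl)
  qed
  have "r j = r 0 + (r 1 - r 0) * real j" if "j \<le> k" for j
    using that
  proof (induction j rule: induct_nat_012)
    case (ge2 j)
    then have "j \<le> k - 2" by linarith
    then have "r (Suc (Suc j)) = 2 * r (Suc j) - r j" using D[of j] by linarith
    then show ?case using ge2 by (simp add: algebra_simps)
  qed auto
  then have "p (Suc k) (Suc j) = (r 0 + (r 1 - r 0) * real j) * p k j" if "j \<le> k" for j
    using that p_pos[OF that] by (metis (no_types) less_irrefl nonzero_divide_eq_eq r_def)
  then show ?thesis by blast
qed

lemma affine_prediction_iff_orth:
  "(\<forall>n\<ge>2. \<forall>k\<in>{1..n}. \<forall>\<phi>. orth n k \<phi> \<longleftrightarrow> degenerate k \<phi>) \<longleftrightarrow> affine_prediction"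
proof
  assume *: "\<forall>n\<ge>2. \<forall>k\<in>{1..n}. \<forall>\<phi>. orth n k \<phi> \<longleftrightarrow> degenerate k \<phi>"
  show affine_prediction
    unfolding affine_prediction_def
  proof
    fix k :: nat
    \<comment> \<open>Through at most two points there is always an affine function, so
      orthogonality enters for \<open>2 \<le> k\<close> only.\<close>
    consider "k = 0" | "k = 1" | "2 \<le> k" by linarith
    then show "\<exists>a b. \<forall>j\<le>k. p (Suc k) (Suc j) = (a + b * real j) * p k j"
    proof cases
      case 1
      then show ?thesis by (intro exI[of _ "p 1 1"]) (simp add: p_00)
    next
      case 2
      have "p 1 0 > 0" "p 1 1 > 0" by (auto intro: p_pos)
      then have "p (Suc 1) (Suc j) = (p 2 1 / p 1 0 + (p 2 2 / p 1 1 - p 2 1 / p 1 0) * real j) * p 1 j"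
        if "j \<le> 1" for j using that by (auto simp: le_Suc_eq numeral_2_eq_2)
      then show ?thesis using 2 by blast
    next
      case 3
      have "degenerate k (\<lambda>j. (-1) ^ j / p k j)" unfolding degenerate_iff by (intro exI[of _ 1]) simp
      then have "orth (Suc k) k (\<lambda>j. (-1) ^ j / p k j)"
        using * 3 by auto
      then show ?thesis using orth_imp_affine_step 3 by blast
    qed
  qed
next
  assume aff: affine_prediction
  have "degenerate k (\<lambda>j. (-1) ^ j / p k j)" for k unfolding degenerate_iff by (intro exI[of _ 1]) simp
  then show "\<forall>n\<ge>2. \<forall>k\<in>{1..n}. \<forall>\<phi>. orth n k \<phi> \<longleftrightarrow> degenerate k \<phi>"
    using orth_imp_degenerate affine_prediction_imp_orth[OF aff] by auto
qed

end

subsection \<open>Solving the consistency equations\<close>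

lemma Beta_real_plus1_left:
  fixes x y :: real
  assumes "0 < x" "0 < y"
  shows "Beta (x + 1) y = x / (x + y) * Beta x y"
proof -
  have "x \<notin> \<int>\<^sub>\<le>\<^sub>0" using assms nonpos_Ints_nonpos by fastforce
  from Beta_plus1_left[OF this, of y] show ?thesis using assms by (simp add: field_simps)
qed

lemma Beta_real_plus1_plus1:
  fixes x y :: real
  assumes "0 < x" "0 < y"
  shows "Beta (x + 1) y + Beta x (y + 1) = Beta x y"
  using assms nonpos_Ints_nonpos by (intro Beta_plus1_plus1) fastforce+

lemma Beta_real_pos: "0 < x \<Longrightarrow> 0 < y \<Longrightarrow> 0 < Beta x (y::real)"
  by (simp add: Beta_def)

context binary_weights
begin

definition iid_weights :: bool where
  "iid_weights \<longleftrightarrow> (\<exists>a. \<forall>n. \<forall>j\<le>n. p n j = a ^ j * (1 - a) ^ (n - j))"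

text \<open>By Euler's integral, these are the integrals of
  \<open>\<theta>^j * (1 - \<theta>)^(n - j)\<close> against the Beta law with parameters \<alpha>
  and \<beta>.\<close>

definition beta_weights :: "real \<Rightarrow> real \<Rightarrow> bool" where
  "beta_weights \<alpha> \<beta> \<longleftrightarrow>
     (\<forall>n. \<forall>j\<le>n. p n j = Beta (\<alpha> + real j) (\<beta> + real (n - j)) / Beta \<alpha> \<beta>)"

text \<open>The predictions determine the weights row by row: they give the entries with at least
  one 1, and the recursion then gives the entry with none.\<close>

lemma weights_eqI:
  assumes q0: "q 0 0 = 1"
    and qrec: "\<And>k j. j \<le> k \<Longrightarrow> q k j = q (Suc k) j + q (Suc k) (Suc j)"
    and r: "\<And>k j. j \<le> k \<Longrightarrow> p (Suc k) (Suc j) = r k j * p k j"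
    and qr: "\<And>k j. j \<le> k \<Longrightarrow> q (Suc k) (Suc j) = r k j * q k j"
  shows "j \<le> n \<Longrightarrow> p n j = q n j"
proof (induction n arbitrary: j)
  case 0
  then show ?case by (simp add: q0 p_00)
next
  case (Suc n)
  show ?case
  proof (cases j)
    case 0
    have "p (Suc n) 0 = p n 0 - r n 0 * p n 0" using p_rec[of 0 n] r[of 0 n] by simp
    moreover have "q (Suc n) 0 = q n 0 - r n 0 * q n 0" using qrec[of 0 n] qr[of 0 n] by simp
    ultimately show ?thesis using Suc.IH[of 0] 0 by simp
  next
    case (Suc i)
    then show ?thesis using r[of i n] qr[of i n] Suc.IH[of i] Suc.prems by simp
  qed
qed

lemma affine_prediction_cases:
  assumes aff: affine_prediction
  shows "iid_weights \<or> (\<exists>\<alpha> \<beta>. 0 < \<alpha> \<and> 0 < \<beta> \<and> beta_weights \<alpha> \<beta>)"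
proof -
  obtain a b where r: "\<And>k j. j \<le> k \<Longrightarrow> p (Suc k) (Suc j) = (a k + b k * real j) * p k j"
    using aff unfolding affine_prediction_def by metis
  have r0: "0 < a k + b k * real j" if "j \<le> k" for k j
    using r[OF that] p_pos[OF that] p_pos[of "Suc j" "Suc k"] that by (simp add: zero_less_mult_iff)
  have r1: "a k + b k * real j < 1" if "j \<le> k" for k j
  proof -
    have "(1 - (a k + b k * real j)) * p k j > 0"
      using r[OF that] p_rec[OF that] p_pos[of j "Suc k"] that by (simp add: algebra_simps)
    then show ?thesis using p_pos[OF that] by (simp add: zero_less_mult_iff)
  qed
  \<comment> \<open>A pattern is extended by a zero and then a one with the same probability as by a
    one and then a zero: \<open>?s j * (1 - ?r) = (1 - ?s (Suc j)) * ?r\<close>.\<close>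
  have cons: "(a k + b k * real j) * (1 - b (Suc k)) = a (Suc k) + b (Suc k) * real j" if j: "j \<le> k" for k j
  proof -
    let ?r = "a k + b k * real j" and ?s = "\<lambda>j. a (Suc k) + b (Suc k) * real j"
    have "(1 - ?r) * p k j = p (Suc k) j"
      unfolding left_diff_distrib mult_1_left using p_rec[OF j] r[OF j] by linarith
    then have "?s j * ((1 - ?r) * p k j) = ?s j * p (Suc k) j" by simp
    also have "\<dots> = p (Suc (Suc k)) (Suc j)" using r[of j "Suc k"] j by simp
    also have "\<dots> = p (Suc k) (Suc j) - p (Suc (Suc k)) (Suc (Suc j))"
      using p_rec[of "Suc j" "Suc k"] j by simp
    also have "\<dots> = (1 - ?s (Suc j)) * (?r * p k j)"
      unfolding left_diff_distrib mult_1_left using r[of "Suc j" "Suc k"] r[OF j] j by simp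
    finally have "(?s j * (1 - ?r)) * p k j = ((1 - ?s (Suc j)) * ?r) * p k j"
      by (simp only: mult.assoc)
    then have "?s j * (1 - ?r) = (1 - ?s (Suc j)) * ?r" using p_pos[OF j] by simp
    then show ?thesis by (simp add: algebra_simps)
  qed
  have a_rec: "a (Suc k) = a k * (1 - b (Suc k))" for k using cons[of 0 k] by simp
  \<comment> \<open>For \<open>k = 0\<close> the only argument is \<open>j = 0\<close>, so
    \<open>b 0\<close> is arbitrary; the recursion of the slopes starts at
    \<open>b 1\<close>.\<close>
  have b_rec: "b (Suc k) * (1 + b k) = b k" if "1 \<le> k" for k
    using cons[of 1 k] that a_rec[of k] by (simp add: algebra_simps)
  \<comment> \<open>Two probabilities strictly between 0 and 1 differ by less than 1.\<close>
  have b_less: "\<bar>b k\<bar> < 1" if "1 \<le> k" for k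
    using r0[of 0 k] r1[of 0 k] r0[of 1 k] r1[of 1 k] that by auto
  consider "b 1 = 0" | "b 1 < 0" | "b 1 > 0" by linarith
  then show ?thesis
  proof cases
    case 1
    have b0: "b (Suc k) = 0" for k
    proof (induction k)
      case (Suc k)
      then show ?case using b_rec[of "Suc k"] by simp
    qed (use 1 in simp)
    then have a0: "a k = a 0" for k by (induction k) (simp_all add: a_rec)
    have rr: "a k + b k * real j = a 0" if "j \<le> k" for k j
      using b0[of "k - 1"] a0[of k] that by (cases k) auto
    have "p n j = a 0 ^ j * (1 - a 0) ^ (n - j)" if "j \<le> n" for n j
    proof (rule weights_eqI[where r = "\<lambda>_ _. a 0"])
      fix k j :: nat assume "j \<le> k"
      then show "a 0 ^ j * (1 - a 0) ^ (k - j) = a 0 ^ j * (1 - a 0) ^ (Suc k - j) + a 0 ^ Suc j * (1 - a 0) ^ (Suc k - Suc j)"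
        by (simp add: Suc_diff_le algebra_simps)
    qed (use r rr that in auto)
    then show ?thesis unfolding iid_weights_def by blast
  next
    case 2
    \<comment> \<open>\<open>-1/b k\<close> would stay positive although it drops by \<open>1\<close> in every step.\<close>
    have "b (Suc k) < 0 \<and> - 1 / b (Suc k) = - 1 / b 1 - real k" for k
    proof (induction k)
      case (Suc k)
      have "b (Suc (Suc k)) * (1 + b (Suc k)) = b (Suc k)" "\<bar>b (Suc k)\<bar> < 1"
        using b_rec[of "Suc k"] b_less[of "Suc k"] by auto
      then have e: "b (Suc (Suc k)) = b (Suc k) / (1 + b (Suc k))" and p: "1 + b (Suc k) > 0"
        by (auto simp: field_simps)
      then have "b (Suc (Suc k)) < 0" using Suc by (simp add: divide_less_0_iff)
      moreover have "- 1 / b (Suc (Suc k)) = - 1 / b (Suc k) - 1"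
        unfolding e using p Suc by (simp add: field_simps)
      ultimately show ?case using Suc by simp
    qed (use 2 in simp)
    moreover obtain k where "- 1 / b 1 < real k" using reals_Archimedean2 by blast
    ultimately have "- 1 / b (Suc k) < 0" "b (Suc k) < 0" by (metis diff_less_0_iff_less, blast)
    then show ?thesis by (simp add: divide_less_0_iff)
  next
    case 3
    \<comment> \<open>For a Beta law the prediction is
      \<open>(\<alpha> + j) / (\<alpha> + \<beta> + k)\<close>. At \<open>k = 1\<close> the slope
      identifies \<open>c\<close> with \<open>\<alpha> + \<beta>\<close>, and the intercept gives
      \<alpha>; the second parameter is \<open>c - \<alpha>\<close>.\<close>
    define c where "c = 1 / b 1 - 1"
    define \<alpha> where "\<alpha> = a 1 * (c + 1)"
    have c: "c > 0" using b_less[of 1] 3 by (simp add: c_def field_simps)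
    have ab: "b (Suc k) = 1 / (c + real (Suc k)) \<and> a (Suc k) = \<alpha> / (c + real (Suc k))" for k
    proof (induction k)
      case 0
      show ?case using 3 by (simp add: c_def \<alpha>_def)
    next
      case (Suc k)
      have pos: "c + real (Suc k) > 0" using c by simp
      have "b (Suc (Suc k)) * (1 + b (Suc k)) = b (Suc k)" using b_rec[of "Suc k"] by simp
      then have bb: "b (Suc (Suc k)) = 1 / (c + real (Suc (Suc k)))"
        using Suc pos by (simp add: field_simps)
      moreover have "a (Suc (Suc k)) = \<alpha> / (c + real (Suc (Suc k)))"
        unfolding a_rec[of "Suc k"] bb using Suc pos by (simp add: field_simps)
      ultimately show ?case by simp
    qed
    have a1: "a 1 = \<alpha> / (c + 1)" "b 1 = 1 / (c + 1)" using ab[of 0] by auto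
    have \<alpha>: "\<alpha> > 0" using r0[of 0 1] c by (simp add: \<alpha>_def)
    \<comment> \<open>Positivity of \<open>c - \<alpha>\<close> expresses that after a first one a
      second one is not certain.\<close>
    have "\<alpha> / (c + 1) + 1 / (c + 1) < 1" using r1[of 1 1, unfolded a1] by simp
    then have \<beta>: "c - \<alpha> > 0" using c by (simp add: field_simps)
    have "\<alpha> / (c + 1) = a 0 * (1 - 1 / (c + 1))" using a_rec[of 0] ab[of 0] by simp
    then have a0: "a 0 = \<alpha> / c" using c by (simp add: field_simps)
    have rr: "a k + b k * real j = (\<alpha> + real j) / (c + real k)" if "j \<le> k" for k j
      using ab[of "k - 1"] a0 that by (cases k) (auto simp: add_divide_distrib)
    let ?q = "\<lambda>n j. Beta (\<alpha> + real j) (c - \<alpha> + real (n - j)) / Beta \<alpha> (c - \<alpha>)"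
    have "p n j = ?q n j" if "j \<le> n" for n j
    proof (rule weights_eqI[where r = "\<lambda>k j. (\<alpha> + real j) / (c + real k)"])
      show "?q 0 0 = 1" using Beta_real_pos[OF \<alpha> \<beta>] by simp
      fix k j :: nat assume j: "j \<le> k"
      have pos: "\<alpha> + real j > 0" "c - \<alpha> + real (k - j) > 0" using \<alpha> \<beta> by (auto intro: add_pos_nonneg)
      show "?q k j = ?q (Suc k) j + ?q (Suc k) (Suc j)"
        using Beta_real_plus1_plus1[OF pos] j by (simp add: Suc_diff_le ac_simps flip: add_divide_distrib)
      have "\<alpha> + real j + (c - \<alpha> + real (k - j)) = c + real k" using j by simp
      then show "?q (Suc k) (Suc j) = (\<alpha> + real j) / (c + real k) * ?q k j"
        using Beta_real_plus1_left[OF pos] by (simp add: ac_simps)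
      show "p (Suc k) (Suc j) = (\<alpha> + real j) / (c + real k) * p k j"
        using r[OF j] rr[OF j] by simp
    qed (rule that)
    then show ?thesis using \<alpha> \<beta> unfolding beta_weights_def by blast
  qed
qed

lemma iid_weights_imp_affine: "iid_weights \<Longrightarrow> affine_prediction"
proof -
  assume iid_weights
  then obtain a where "\<forall>n. \<forall>j\<le>n. p n j = a ^ j * (1 - a) ^ (n - j)"
    unfolding iid_weights_def by blast
  then have "p (Suc k) (Suc j) = (a + 0 * real j) * p k j" if "j \<le> k" for j k
    using that by simp
  then show affine_prediction unfolding affine_prediction_def by blast
qed

lemma beta_weights_imp_affine:
  assumes "0 < \<alpha>" "0 < \<beta>" "beta_weights \<alpha> \<beta>"
  shows affine_prediction
proof -
  have "p (Suc k) (Suc j) = (\<alpha> / (\<alpha> + \<beta> + real k) + 1 / (\<alpha> + \<beta> + real k) * real j) * p k j"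
    if "j \<le> k" for j k
  proof -
    have pos: "\<alpha> + real j > 0" "\<beta> + real (k - j) > 0" using assms by (auto intro: add_pos_nonneg)
    have s: "\<alpha> + real j + (\<beta> + real (k - j)) = \<alpha> + \<beta> + real k" using that by simp
    have "Beta (\<alpha> + real (Suc j)) (\<beta> + real (k - j)) =
        (\<alpha> + real j) / (\<alpha> + \<beta> + real k) * Beta (\<alpha> + real j) (\<beta> + real (k - j))"
      using Beta_real_plus1_left[OF pos] unfolding s by (simp add: ac_simps)
    then show ?thesis
      using assms(3) that unfolding beta_weights_def by (simp add: add_divide_distrib)
  qed
  then show ?thesis unfolding affine_prediction_def by blast
qed

lemma affine_prediction_iff:
  "affine_prediction \<longleftrightarrow> iid_weights \<or> (\<exists>\<alpha> \<beta>. 0 < \<alpha> \<and> 0 < \<beta> \<and> beta_weights \<alpha> \<beta>)"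
  using affine_prediction_cases iid_weights_imp_affine beta_weights_imp_affine by blast

end

subsection \<open>Moments of laws on the unit interval\<close>

lemma unit_interval_measure:
  fixes \<gamma> :: "real measure"
  assumes "sets \<gamma> = sets (restrict_space borel {0..1})"
  shows "space \<gamma> = {0..1}" and "f \<in> borel_measurable borel \<Longrightarrow> f \<in> borel_measurable \<gamma>"
proof -
  show "space \<gamma> = {0..1}"
    using sets_eq_imp_space_eq[OF assms] by (simp add: space_restrict_space)
  show "f \<in> borel_measurable \<gamma>" if "f \<in> borel_measurable borel"
    unfolding measurable_cong_sets[OF assms refl] using that by (rule measurable_restrict_space1)
qed

text \<open>Absolute moments on the unit interval are at most 1, so the error of the Taylor
  polynomial of the characteristic function is at most twice a term of the exponential
  series.\<close>

lemma unit_interval_moments_char: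
  fixes \<gamma> :: "real measure"
  assumes "prob_space \<gamma>" and s: "sets \<gamma> = sets (restrict_space borel {0..1})"
  shows "(\<lambda>n. \<Sum>k\<le>n. ((\<i> * t) ^ k / fact k) * (LINT x|\<gamma>. x ^ k)) \<longlonglongrightarrow> char (distr \<gamma> borel (\<lambda>x. x)) t"
proof -
  interpret prob_space \<gamma> by fact
  note sp = unit_interval_measure(1)[OF s]
  have m: "(\<lambda>x. x ^ k) \<in> borel_measurable \<gamma>" for k
    by (rule unit_interval_measure(2)[OF s]) simp
  have int: "integrable \<gamma> (\<lambda>x. x ^ k)" for k
    by (rule integrable_const_bound[where B = 1]) (auto simp: sp m power_le_one)
  have "cmod (char (distr \<gamma> borel (\<lambda>x. x)) t - (\<Sum>k\<le>n. ((\<i> * t) ^ k / fact k) * (LINT x|\<gamma>. x ^ k)))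
      \<le> 2 * (\<bar>t\<bar> ^ n / fact n)" for n
  proof -
    have "(LINT x|\<gamma>. \<bar>x\<bar> ^ n) = (LINT x|\<gamma>. x ^ n)"
      by (intro Bochner_Integration.integral_cong) (auto simp: sp)
    also have "\<dots> \<le> (LINT x|\<gamma>. 1)"
      using int by (intro integral_mono) (auto simp: sp power_le_one)
    also have "\<dots> = 1" by (simp add: prob_space)
    finally have "(2 * \<bar>t\<bar> ^ n / fact n) * (LINT x|\<gamma>. \<bar>x\<bar> ^ n) \<le> 2 * \<bar>t\<bar> ^ n / fact n"
      by (intro mult_left_le) auto
    moreover have "cmod (char (distr \<gamma> borel (\<lambda>x. x)) t - (\<Sum>k\<le>n. ((\<i> * t) ^ k / fact k) * (LINT x|\<gamma>. x ^ k)))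
      \<le> (2 * \<bar>t\<bar> ^ n / fact n) * (LINT x|\<gamma>. \<bar>x\<bar> ^ n)"
      using int m[of 1] by (intro char_approx1') auto
    ultimately show ?thesis by simp
  qed
  note bound = this
  have "(\<lambda>n. \<bar>t\<bar> ^ n / fact n) \<longlonglongrightarrow> 0"
    using summable_LIMSEQ_zero[OF summable_exp[of "\<bar>t\<bar>"]] by (simp add: divide_inverse mult.commute)
  from tendsto_mult_right_zero[OF this] have lim: "(\<lambda>n. 2 * (\<bar>t\<bar> ^ n / fact n)) \<longlonglongrightarrow> 0" .
  have "(\<lambda>n. char (distr \<gamma> borel (\<lambda>x. x)) t - (\<Sum>k\<le>n. ((\<i> * t) ^ k / fact k) * (LINT x|\<gamma>. x ^ k))) \<longlonglongrightarrow> 0"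
    by (rule Lim_null_comparison[OF always_eventually lim]) (rule allI, rule bound)
  from tendsto_diff[OF tendsto_const this, of "char (distr \<gamma> borel (\<lambda>x. x)) t"]
  show ?thesis by simp
qed

text \<open>Equal moments give equal characteristic functions, and Levy's uniqueness theorem applies
  to the images on the real line. Measurable subsets of the unit interval are Borel, so the images
  determine the measures.\<close>

lemma unit_interval_moments_unique:
  fixes \<gamma> \<gamma>' :: "real measure"
  assumes g: "prob_space \<gamma>" "sets \<gamma> = sets (restrict_space borel {0..1})"
    and g': "prob_space \<gamma>'" "sets \<gamma>' = sets (restrict_space borel {0..1})"
    and eq: "\<And>n. n \<ge> 1 \<Longrightarrow> (LINT x|\<gamma>. x ^ n) = (LINT x|\<gamma>'. x ^ n)"
  shows "\<gamma> = \<gamma>'"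
proof -
  have eq': "(LINT x|\<gamma>. x ^ n) = (LINT x|\<gamma>'. x ^ n)" for n
    using eq[of n] g(1) g'(1) by (cases n) (auto simp: prob_space.prob_space)
  have id: "(\<lambda>x. x) \<in> borel_measurable \<gamma>" "(\<lambda>x. x) \<in> borel_measurable \<gamma>'"
    by (rule unit_interval_measure(2)[OF g(2)] unit_interval_measure(2)[OF g'(2)], simp)+
  have "char (distr \<gamma> borel (\<lambda>x. x)) = char (distr \<gamma>' borel (\<lambda>x. x))"
  proof
    fix t
    show "char (distr \<gamma> borel (\<lambda>x. x)) t = char (distr \<gamma>' borel (\<lambda>x. x)) t"
      using unit_interval_moments_char[OF g, of t] unit_interval_moments_char[OF g', of t]
      unfolding eq' by (rule LIMSEQ_unique)
  qed
  then have D: "distr \<gamma> borel (\<lambda>x. x) = distr \<gamma>' borel (\<lambda>x. x)"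
    using g g' id by (intro Levy_uniqueness prob_space.real_distribution_distr) auto
  show ?thesis
  proof (rule measure_eqI)
    show "sets \<gamma> = sets \<gamma>'" using g g' by simp
    fix A assume A: "A \<in> sets \<gamma>"
    then have B: "A \<in> sets borel" "A \<subseteq> {0..1}"
      unfolding g(2) by (auto simp: sets_restrict_space_iff)
    have "emeasure (distr \<gamma> borel (\<lambda>x. x)) A = emeasure \<gamma> A"
      "emeasure (distr \<gamma>' borel (\<lambda>x. x)) A = emeasure \<gamma>' A"
      using B id unit_interval_measure(1) g(2) g'(2) by (auto simp: emeasure_distr Int_absorb2)
    then show "emeasure \<gamma> A = emeasure \<gamma>' A" using D by simp
  qed
qed

text \<open>Tightness yields a weak limit along a subsequence. Powers of the clipped variable are
  bounded and continuous, so the moments pass to the limit.\<close>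

lemma (in prob_space) unit_interval_moment_limit:
  fixes Y :: "nat \<Rightarrow> 'a \<Rightarrow> real"
  assumes Y[measurable]: "\<And>n. Y n \<in> borel_measurable M"
    and bound: "\<And>n \<omega>. \<omega> \<in> space M \<Longrightarrow> Y n \<omega> \<in> {0..1}"
    and lim: "\<And>k. (\<lambda>n. expectation (\<lambda>\<omega>. Y n \<omega> ^ k)) \<longlonglongrightarrow> m k"
  shows "\<exists>\<gamma>. prob_space \<gamma> \<and> sets \<gamma> = sets (restrict_space borel {0..1}) \<and> (\<forall>k. (LINT x|\<gamma>. x ^ k) = m k)"
proof -
  define \<mu> where "\<mu> n = distr M borel (Y n)" for n
  have rd: "real_distribution (\<mu> n)" for n
    unfolding \<mu>_def by (rule real_distribution_distr) measurable
  \<comment> \<open>Tightness is stated with intervals open on the left, hence the end point -1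
    instead of 0.\<close>
  have "measure (\<mu> n) {-1<..1} = 1" for n
  proof -
    have "Y n -` {-1<..1} \<inter> space M = space M" using bound[of _ n] by force
    then show ?thesis unfolding \<mu>_def by (simp add: measure_distr prob_space)
  qed
  then have "tight \<mu>"
    unfolding tight_def using rd by (intro conjI allI impI exI[of _ "-1"] exI[of _ "1::real"]) auto
  then obtain r N where r: "strict_mono (r :: nat \<Rightarrow> nat)" and N: "real_distribution N"
    and w: "weak_conv_m (\<mu> \<circ> id \<circ> r) N"
    using tight_imp_convergent_subsubsequence[of \<mu> id] by (auto simp: strict_mono_def)
  interpret N: real_distribution N by fact
  \<comment> \<open>Clipping makes the powers bounded and continuous on the whole line and pushes
    \<open>N\<close> onto the unit interval, so that the support of \<open>N\<close> need not be
    examined.\<close>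
  define clip :: "real \<Rightarrow> real" where "clip x = max 0 (min 1 x)" for x
  have clip_meas: "clip \<in> borel_measurable borel" unfolding clip_def by measurable
  have clip: "clip \<in> measurable N (restrict_space borel {0..1})"
    using clip_meas by (intro measurable_restrict_space2) (auto simp: clip_def)
  define \<gamma> where "\<gamma> = distr N (restrict_space borel {0..1}) clip"
  have "(LINT x|\<gamma>. x ^ k) = m k" for k
  proof -
    have "(LINT x|\<gamma>. x ^ k) = (LINT x|N. clip x ^ k)"
      unfolding \<gamma>_def by (rule integral_distr[OF clip]) (auto intro: measurable_restrict_space1)
    moreover have "(\<lambda>n. LINT x|(\<mu> \<circ> id \<circ> r) n. clip x ^ k) \<longlonglongrightarrow> (LINT x|N. clip x ^ k)"
    proof (rule weak_conv_imp_integral_bdd_continuous_conv[OF _ N w])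
      show "isCont (\<lambda>x. clip x ^ k) x" for x
        unfolding clip_def by (intro continuous_intros)
      show "norm (clip x ^ k) \<le> 1" for x
        by (auto simp: clip_def power_le_one)
    qed (simp add: rd)
    moreover have "(LINT x|(\<mu> \<circ> id \<circ> r) n. clip x ^ k) = expectation (\<lambda>\<omega>. Y (r n) \<omega> ^ k)" for n
    proof -
      have "(LINT x|(\<mu> \<circ> id \<circ> r) n. clip x ^ k) = expectation (\<lambda>\<omega>. clip (Y (r n) \<omega>) ^ k)"
        using clip_meas unfolding \<mu>_def o_def id_def by (intro integral_distr) auto
      also have "\<dots> = expectation (\<lambda>\<omega>. Y (r n) \<omega> ^ k)"
        using bound by (intro Bochner_Integration.integral_cong) (auto simp: clip_def)
      finally show ?thesis .
    qed
    ultimately have "(\<lambda>n. expectation (\<lambda>\<omega>. Y (r n) \<omega> ^ k)) \<longlonglongrightarrow> (LINT x|\<gamma>. x ^ k)"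
      by simp
    moreover have "(\<lambda>n. expectation (\<lambda>\<omega>. Y (r n) \<omega> ^ k)) \<longlonglongrightarrow> m k"
      using LIMSEQ_subseq_LIMSEQ[OF lim r] by (simp add: o_def)
    ultimately show ?thesis by (rule LIMSEQ_unique)
  qed
  moreover have "prob_space \<gamma>" unfolding \<gamma>_def using clip by (rule N.prob_space_distr)
  moreover have "sets \<gamma> = sets (restrict_space borel {0..1})" by (simp add: \<gamma>_def)
  ultimately show ?thesis by blast
qed

subsection \<open>Exchangeable binary sequences and de Finetti's theorem\<close>

text \<open>The bijection is glued from the blocks \<open>S\<close>, \<open>T - S\<close> and
  \<open>U - T\<close>. It supplies the permutation that carries a standard pattern to an arbitrary
  one.\<close>

lemma bij_betw_chain_extension:
  assumes "finite U" "S \<subseteq> T" "T \<subseteq> U" "finite U'" "S' \<subseteq> T'" "T' \<subseteq> U'"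
    and "card S = card S'" "card T = card T'" "card U = card U'"
  shows "\<exists>f. bij_betw f U U' \<and> f ` S = S' \<and> f ` T = T'"
proof -
  have fin: "finite S" "finite T" "finite S'" "finite T'"
    using assms finite_subset by metis+
  obtain f where f: "bij_betw f S S'" using fin assms finite_same_card_bij by metis
  obtain g where g: "bij_betw g (T - S) (T' - S')"
    using fin assms finite_same_card_bij[of "T - S" "T' - S'"] by (auto simp: card_Diff_subset)
  obtain h where h: "bij_betw h (U - T) (U' - T')"
    using fin assms finite_same_card_bij[of "U - T" "U' - T'"] by (auto simp: card_Diff_subset)
  define F where "F x = (if x \<in> S then f x else if x \<in> T then g x else h x)" for x
  have F1: "bij_betw F S S'"
    using f by (rule bij_betw_cong[THEN iffD1, rotated]) (auto simp: F_def)
  have F2: "bij_betw F (T - S) (T' - S')"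
    using g by (rule bij_betw_cong[THEN iffD1, rotated]) (auto simp: F_def)
  have F3: "bij_betw F (U - T) (U' - T')"
    using h by (rule bij_betw_cong[THEN iffD1, rotated]) (use assms in \<open>auto simp: F_def\<close>)
  have T: "bij_betw F T T'"
    using bij_betw_combine[OF F1 F2] assms by (simp add: Un_absorb1)
  have "bij_betw F U U'"
    using bij_betw_combine[OF T F3] assms by (simp add: Un_absorb1)
  with T F1 show ?thesis by (auto simp: bij_betw_def)
qed

section \<open>Pattern probabilities of an exchangeable sequence\<close>

locale exchangeable_binary = prob_space M for M :: "'a measure" +
  fixes X :: "nat \<Rightarrow> 'a \<Rightarrow> nat"
  assumes X_meas: "n \<ge> 1 \<Longrightarrow> X n \<in> measurable M bin"
    and X_exch: "exchangeable M X"
begin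

definition ones :: "nat set \<Rightarrow> 'a \<Rightarrow> nat set" where
  "ones I \<omega> = {i \<in> I. X i \<omega> = 1}"

text \<open>The representative pattern has its ones in front; by \<open>prob_ones\<close> any other
  with \<open>j\<close> ones has the same probability.\<close>

definition weight :: "nat \<Rightarrow> nat \<Rightarrow> real" where
  "weight n j = prob {\<omega> \<in> space M. ones {1..n} \<omega> = {1..j}}"

lemma X_values: "i \<ge> 1 \<Longrightarrow> \<omega> \<in> space M \<Longrightarrow> X i \<omega> = 0 \<or> X i \<omega> = 1"
  using measurable_space[OF X_meas, of i \<omega>] by auto

lemma ones_subset: "ones I \<omega> \<subseteq> I"
  by (auto simp: ones_def)

lemma event_X: "i \<ge> 1 \<Longrightarrow> {\<omega> \<in> space M. X i \<omega> = 1} \<in> events"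
proof -
  assume i: "i \<ge> 1"
  have "X i -` {1} \<inter> space M \<in> events" using X_meas[OF i] by (rule measurable_sets) auto
  also have "X i -` {1} \<inter> space M = {\<omega> \<in> space M. X i \<omega> = 1}" by auto
  finally show ?thesis .
qed

lemma event_ones:
  assumes "finite I" "I \<subseteq> {1..}"
  shows "{\<omega> \<in> space M. ones I \<omega> = B} \<in> events"
proof (cases "B \<subseteq> I")
  case True
  have "{\<omega> \<in> space M. \<forall>i\<in>I. (X i \<omega> = 1) = (i \<in> B)} \<in> events"
  proof (rule sets.sets_Collect_finite_All)
    fix i assume "i \<in> I"
    then have *: "{\<omega> \<in> space M. X i \<omega> = 1} \<in> events" using assms event_X by auto
    show "{\<omega> \<in> space M. (X i \<omega> = 1) = (i \<in> B)} \<in> events"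
      using * sets.sets_Collect_neg[OF *] by (cases "i \<in> B") simp_all
  qed fact
  moreover have "{\<omega> \<in> space M. ones I \<omega> = B} = {\<omega> \<in> space M. \<forall>i\<in>I. (X i \<omega> = 1) = (i \<in> B)}"
    using True by (auto simp: ones_def)
  ultimately show ?thesis by (simp only:)
next
  case False
  then have *: "{\<omega> \<in> space M. ones I \<omega> = B} = {}" using ones_subset by auto
  show ?thesis unfolding * by simp
qed

text \<open>Some permutation of \<open>{1..N}\<close> carries the initial segments of lengths
  \<open>card B\<close> and \<open>card I\<close> onto \<open>B\<close> and \<open>I\<close>.
  Exchangeability then reduces every pattern on a finite index set to the standard one.\<close>

lemma prob_ones:
  assumes I: "finite I" "I \<subseteq> {1..}" and B: "B \<subseteq> I"
  shows "prob {\<omega> \<in> space M. ones I \<omega> = B} = weight (card I) (card B)"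
proof -
  obtain N where N: "I \<subseteq> {1..N}" "N \<ge> 1"
  proof -
    have "I \<subseteq> {1..Suc (Max (insert 0 I))}"
    proof
      fix x assume "x \<in> I"
      moreover from this have "x \<le> Max (insert 0 I)" using I by simp
      ultimately show "x \<in> {1..Suc (Max (insert 0 I))}" using I(2) by auto
    qed
    then show ?thesis using that by simp
  qed
  have card: "card B \<le> card I" "card I \<le> N"
    using I B N card_mono[of "{1..N}" I] by (auto intro: card_mono)
  obtain f where f: "bij_betw f {1..N} {1..N}" "f ` {1..card B} = B" "f ` {1..card I} = I"
    using bij_betw_chain_extension[of "{1..N}" "{1..card B}" "{1..card I}" "{1..N}" B I] card B N by auto
  define q where "q x = (if x \<in> {1..N} then f x else x)" for x
  have "bij_betw q {1..N} {1..N}"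
    using f(1) by (rule bij_betw_cong[THEN iffD1, rotated]) (simp add: q_def)
  then have perm: "q permutes {1..N}"
    by (rule bij_imp_permutes) (simp only: q_def if_False)
  have inj: "inj_on q {1..N}" using perm by (rule permutes_inj_on)
  have "q ` {1..card B} = f ` {1..card B}" "q ` {1..card I} = f ` {1..card I}"
    using card by (auto simp: q_def intro!: image_cong)
  then have qB: "q ` {1..card B} = B" and qI: "q ` {1..card I} = I" by (simp_all only: f)
  define P where "P = (\<Pi>\<^sub>M i\<in>{1..N}. bin)"
  define S where "S = {x \<in> space P. {i \<in> {1..card I}. x i = (1::nat)} = {1..card B}}"
  have P_eq: "P = count_space (\<Pi>\<^sub>E i\<in>{1..N}. {0, 1})"
    unfolding P_def by (rule count_space_PiM_finite) auto
  have S: "S \<in> sets P" unfolding P_eq S_def by auto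
  define W where "W g \<omega> = (\<lambda>i\<in>{1..N}. X (g i) \<omega>)" for g :: "nat \<Rightarrow> nat" and \<omega>
  have meas: "W g \<in> measurable M P" if "\<And>i. i \<in> {1..N} \<Longrightarrow> g i \<ge> 1" for g
    unfolding P_def W_def using that by (intro measurable_restrict X_meas) auto
  have q1: "q i \<ge> 1" if "i \<in> {1..N}" for i
    using permutes_in_image[OF perm, of i] that by auto
  have m: "W q \<in> measurable M P" "W id \<in> measurable M P"
    by (rule meas, erule q1) (rule meas, simp)
  have W_S: "W g -` S \<inter> space M = {\<omega> \<in> space M. {i \<in> {1..card I}. W g \<omega> i = 1} = {1..card B}}"
    if "W g \<in> measurable M P" for g
    using measurable_space[OF that] unfolding S_def by blast
  have "distr M P (W q) = distr M P (W id)"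
    using X_exch N(2) perm unfolding exchangeable_def P_def W_def id_def by blast
  then have "measure (distr M P (W q)) S = measure (distr M P (W id)) S" by simp
  then have "prob (W q -` S \<inter> space M) = prob (W id -` S \<inter> space M)"
    unfolding measure_distr[OF m(1) S] measure_distr[OF m(2) S] .
  moreover have "{i \<in> {1..card I}. W id \<omega> i = 1} = ones {1..card I} \<omega>" for \<omega>
    using card by (auto simp: ones_def W_def)
  moreover have "{i \<in> {1..card I}. W q \<omega> i = 1} = {1..card B} \<longleftrightarrow> ones I \<omega> = B" for \<omega>
  proof -
    let ?L = "{i \<in> {1..card I}. W q \<omega> i = 1}"
    have "q ` ?L = {i \<in> q ` {1..card I}. X i \<omega> = 1}"
      using card by (auto simp: W_def)
    then have "q ` ?L = ones I \<omega>"
      by (simp only: qI ones_def)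
    moreover have "?L \<subseteq> {1..N}" "{1..card B} \<subseteq> {1..N}" using card by auto
    ultimately show ?thesis
      using inj_on_image_eq_iff[OF inj, of ?L "{1..card B}"] by (simp only: qB)
  qed
  ultimately show ?thesis
    unfolding W_S[OF m(1)] W_S[OF m(2)] weight_def by (simp only:)
qed

lemma expectation_ones:
  fixes h :: "nat set \<Rightarrow> real"
  assumes I: "finite I" "I \<subseteq> {1..}"
  shows "integrable M (\<lambda>\<omega>. h (ones I \<omega>))"
    and "expectation (\<lambda>\<omega>. h (ones I \<omega>)) = (\<Sum>B\<in>Pow I. weight (card I) (card B) * h B)"
proof -
  let ?s = "\<lambda>\<omega>. \<Sum>B\<in>Pow I. indicator {\<omega> \<in> space M. ones I \<omega> = B} \<omega> * h B"
  have eq: "h (ones I \<omega>) = ?s \<omega>" if "\<omega> \<in> space M" for \<omega>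
  proof -
    have "?s \<omega> = (\<Sum>B\<in>{ones I \<omega>}. indicator {\<omega> \<in> space M. ones I \<omega> = B} \<omega> * h B)"
      using I ones_subset by (intro sum.mono_neutral_right) (auto simp: indicator_def)
    then show ?thesis using that by simp
  qed
  have int: "integrable M (\<lambda>\<omega>. indicator {\<omega> \<in> space M. ones I \<omega> = B} \<omega> * h B)" for B
    using event_ones[OF I] by (intro integrable_mult_left) (simp add: emeasure_eq_measure)
  show "integrable M (\<lambda>\<omega>. h (ones I \<omega>))"
    using int by (subst Bochner_Integration.integrable_cong[OF refl eq]) (auto intro!: integrable_sum)
  have "expectation (\<lambda>\<omega>. h (ones I \<omega>)) = expectation ?s"
    by (rule Bochner_Integration.integral_cong[OF refl eq])
  also have "\<dots> = (\<Sum>B\<in>Pow I. prob {\<omega> \<in> space M. ones I \<omega> = B} * h B)"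
    using int event_ones[OF I] by (subst Bochner_Integration.integral_sum) (auto simp: Int_absorb2)
  also have "\<dots> = (\<Sum>B\<in>Pow I. weight (card I) (card B) * h B)"
    using prob_ones[OF I] by (intro sum.cong) auto
  finally show "expectation (\<lambda>\<omega>. h (ones I \<omega>)) = (\<Sum>B\<in>Pow I. weight (card I) (card B) * h B)" .
qed

lemma weight_0_0: "weight 0 0 = 1"
  by (simp add: weight_def ones_def prob_space)

lemma weight_rec:
  assumes "j \<le> k"
  shows "weight k j = weight (Suc k) j + weight (Suc k) (Suc j)"
proof -
  let ?E = "\<lambda>B. {\<omega> \<in> space M. ones {1..Suc k} \<omega> = B}"
  have ins: "{1..Suc k} = insert (Suc k) {1..k}" by auto
  have "ones {1..k} \<omega> = {1..j} \<longleftrightarrow> ones {1..Suc k} \<omega> = {1..j} \<or> ones {1..Suc k} \<omega> = insert (Suc k) {1..j}" for \<omega>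
  proof -
    have notin: "Suc k \<notin> ones {1..k} \<omega>" "Suc k \<notin> {1..j}" using assms by (auto simp: ones_def)
    show ?thesis
    proof (cases "X (Suc k) \<omega> = 1")
      case True
      then have "ones {1..Suc k} \<omega> = insert (Suc k) (ones {1..k} \<omega>)"
        unfolding ones_def ins by auto
      then show ?thesis using notin by (metis insertI1 insert_ident)
    next
      case False
      then have "ones {1..Suc k} \<omega> = ones {1..k} \<omega>"
        unfolding ones_def ins by auto
      then show ?thesis using notin by (metis insertI1)
    qed
  qed
  then have un: "{\<omega> \<in> space M. ones {1..k} \<omega> = {1..j}} = ?E {1..j} \<union> ?E (insert (Suc k) {1..j})" by auto
  have disj: "?E {1..j} \<inter> ?E (insert (Suc k) {1..j}) = {}"
  proof -
    have "Suc k \<notin> {1..j}" using assms by simp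
    then have "{1..j} \<noteq> insert (Suc k) {1..j}" by blast
    then show ?thesis by auto
  qed
  have ev: "?E B \<in> events" for B by (rule event_ones) auto
  have "weight k j = prob (?E {1..j}) + prob (?E (insert (Suc k) {1..j}))"
    unfolding weight_def un by (rule finite_measure_Union[OF ev ev disj])
  moreover have "prob (?E {1..j}) = weight (Suc k) j"
    by (subst prob_ones) (use assms in auto)
  moreover have "prob (?E (insert (Suc k) {1..j})) = weight (Suc k) (Suc j)"
    by (subst prob_ones) (use assms in auto)
  ultimately show ?thesis by simp
qed

text \<open>The binomial coefficient counts the \<open>k\<close>-subsets of \<open>{1..n}\<close> on
  which all coordinates are one, and each of them has probability \<open>weight k k\<close> of being
  so.\<close>

lemma expectation_binomial_count:
  "expectation (\<lambda>\<omega>. real (card (ones {1..n} \<omega>) choose k)) = real (n choose k) * weight k k"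
proof -
  let ?\<J> = "{J. J \<subseteq> {1..n} \<and> card J = k}"
  have count: "real (card (ones {1..n} \<omega>) choose k) = (\<Sum>J\<in>?\<J>. of_bool (ones J \<omega> = J))" for \<omega>
  proof -
    have "(\<Sum>J\<in>?\<J>. of_bool (ones J \<omega> = J)) = real (card (?\<J> \<inter> {J. ones J \<omega> = J}))"
      by (subst sum_of_bool_eq) auto
    also have "?\<J> \<inter> {J. ones J \<omega> = J} = {J. J \<subseteq> ones {1..n} \<omega> \<and> card J = k}"
      by (auto simp: ones_def)
    also have "real (card \<dots>) = real (card (ones {1..n} \<omega>) choose k)"
      using n_subsets[of "ones {1..n} \<omega>" k] finite_subset[OF ones_subset] by auto
    finally show ?thesis by simp
  qed
  have J: "finite J" "J \<subseteq> {1..}" if "J \<in> ?\<J>" for J using that finite_subset by auto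
  have "expectation (\<lambda>\<omega>. real (card (ones {1..n} \<omega>) choose k)) = (\<Sum>J\<in>?\<J>. expectation (\<lambda>\<omega>. of_bool (ones J \<omega> = J)))"
    unfolding count
  proof (rule Bochner_Integration.integral_sum)
    fix J assume "J \<in> ?\<J>"
    from J[OF this] show "integrable M (\<lambda>\<omega>. of_bool (ones J \<omega> = J) :: real)"
      by (rule expectation_ones(1)[where h = "\<lambda>B. of_bool (B = J)"])
  qed
  also have "\<dots> = (\<Sum>J\<in>?\<J>. weight k k)"
  proof (rule sum.cong[OF refl])
    fix J assume j: "J \<in> ?\<J>"
    have "expectation (\<lambda>\<omega>. of_bool (ones J \<omega> = J)) = (\<Sum>B\<in>Pow J. weight (card J) (card B) * of_bool (B = J))"
      by (rule expectation_ones(2)[OF J[OF j]])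
    also have "\<dots> = (\<Sum>B\<in>{J}. weight (card J) (card B) * of_bool (B = J))"
      using J[OF j] by (intro sum.mono_neutral_right) auto
    finally show "expectation (\<lambda>\<omega>. of_bool (ones J \<omega> = J)) = weight k k" using j by simp
  qed
  also have "\<dots> = real (n choose k) * weight k k"
    using n_subsets[of "{1..n}" k] by simp
  finally show ?thesis .
qed

text \<open>This makes a weak limit of the empirical frequencies the mixing law in
  \<open>de_finetti\<close>.\<close>

lemma frequency_moments_limit:
  "(\<lambda>n. expectation (\<lambda>\<omega>. (real (card (ones {1..Suc n} \<omega>)) / real (Suc n)) ^ k)) \<longlonglongrightarrow> weight k k"
proof -
  define Y where "Y n \<omega> = real (card (ones {1..Suc n} \<omega>)) / real (Suc n)" for n \<omega>
  have Y: "0 \<le> Y n \<omega>" "Y n \<omega> \<le> 1" for n \<omega>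
    using card_mono[OF _ ones_subset, of "{1..Suc n}" \<omega>] by (auto simp: Y_def)
  have falling: "(\<Prod>i<k. real s / real (Suc n) - real i / real (Suc n)) = fact k * real (s choose k) / real (Suc n) ^ k" for s n
    by (simp add: binomial_gbinomial gbinomial_prod_rev atLeast0LessThan prod_dividef flip: diff_divide_distrib)
  have int: "integrable M (\<lambda>\<omega>. g (Y n \<omega>))" for g :: "real \<Rightarrow> real" and n
    unfolding Y_def by (rule expectation_ones(1)[where h = "\<lambda>B. g (real (card B) / real (Suc n))"]) auto
  define c where "c n = (\<Prod>i<k. 1 - real i / real (Suc n))" for n
  \<comment> \<open>Falling factorials have exact expectations and approximate the powers up to \<open>O(1/n)\<close>.\<close>
  have E: "expectation (\<lambda>\<omega>. \<Prod>i<k. Y n \<omega> - real i / real (Suc n)) = c n * weight k k" for n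
  proof -
    have "expectation (\<lambda>\<omega>. \<Prod>i<k. Y n \<omega> - real i / real (Suc n)) =
      expectation (\<lambda>\<omega>. (fact k / real (Suc n) ^ k) * real (card (ones {1..Suc n} \<omega>) choose k))"
      unfolding Y_def falling by simp
    also have "\<dots> = (fact k / real (Suc n) ^ k) * (real (Suc n choose k) * weight k k)"
      by (simp only: expectation_binomial_count integral_mult_right_zero)
    also have "\<dots> = c n * weight k k"
      using falling[of "Suc n" n] by (simp add: c_def)
    finally show ?thesis .
  qed
  have c: "c \<longlonglongrightarrow> 1"
  proof -
    have "c \<longlonglongrightarrow> (\<Prod>i<k. 1 - 0)"
      unfolding c_def by (intro tendsto_intros LIMSEQ_Suc[OF lim_const_over_n])
    then show ?thesis by simp
  qed
  \<comment> \<open>The condition \<open>k \<le> n\<close> keeps every factor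
    \<open>Y n \<omega> - i / Suc n\<close> between -1 and 1, as the comparison of products
    requires.\<close>
  have "norm (expectation (\<lambda>\<omega>. Y n \<omega> ^ k) - c n * weight k k) \<le> (\<Sum>i<k. real i) / real (Suc n)" if n: "k \<le> n" for n
  proof -
    have diff: "\<bar>Y n \<omega> ^ k - (\<Prod>i<k. Y n \<omega> - real i / real (Suc n))\<bar> \<le> (\<Sum>i<k. real i) / real (Suc n)" for \<omega>
    proof -
      have "norm ((\<Prod>i<k. Y n \<omega>) - (\<Prod>i<k. Y n \<omega> - real i / real (Suc n))) \<le>
          (\<Sum>i<k. norm (Y n \<omega> - (Y n \<omega> - real i / real (Suc n))))"
      proof (rule norm_prod_diff)
        fix i assume "i \<in> {..<k}"
        then have "real i / real (Suc n) \<le> 1" "0 \<le> real i / real (Suc n)" using n by auto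
        then show "norm (Y n \<omega> - real i / real (Suc n)) \<le> 1"
          using Y[of n \<omega>] unfolding real_norm_def abs_le_iff by linarith
      qed (use Y in auto)
      then show ?thesis by (simp add: sum_divide_distrib)
    qed
    have "expectation (\<lambda>\<omega>. Y n \<omega> ^ k) - c n * weight k k =
      expectation (\<lambda>\<omega>. Y n \<omega> ^ k - (\<Prod>i<k. Y n \<omega> - real i / real (Suc n)))"
      unfolding E[symmetric] by (rule Bochner_Integration.integral_diff[symmetric]) (rule int)+
    also have "norm \<dots> \<le> expectation (\<lambda>\<omega>. norm (Y n \<omega> ^ k - (\<Prod>i<k. Y n \<omega> - real i / real (Suc n))))"
      by (rule integral_norm_bound)
    also have "\<dots> \<le> expectation (\<lambda>\<omega>. (\<Sum>i<k. real i) / real (Suc n))"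
      using diff by (intro integral_mono int) auto
    finally show ?thesis by (simp add: prob_space)
  qed
  then have "(\<lambda>n. expectation (\<lambda>\<omega>. Y n \<omega> ^ k) - c n * weight k k) \<longlonglongrightarrow> 0"
    by (intro Lim_null_comparison[OF _ LIMSEQ_Suc[OF lim_const_over_n]]) (auto simp: eventually_sequentially)
  from tendsto_add[OF this tendsto_mult[OF c tendsto_const[of "weight k k"]]]
  show ?thesis by (simp add: Y_def)
qed

text \<open>Induction on the number of zeros: expanding one factor \<open>1 - \<theta>\<close> is
  the counterpart of \<open>weight_rec\<close> for the integrals.\<close>

lemma mixture_weight:
  assumes "prob_space \<gamma>" and s: "sets \<gamma> = sets (restrict_space borel {0..1})"
    and mom: "\<And>k. k \<ge> 1 \<Longrightarrow> (LINT \<theta>|\<gamma>. \<theta> ^ k) = weight k k"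
  shows "j \<le> n \<Longrightarrow> (LINT \<theta>|\<gamma>. \<theta> ^ j * (1 - \<theta>) ^ (n - j)) = weight n j"
proof -
  interpret \<gamma>: prob_space \<gamma> by fact
  note sp = unit_interval_measure(1)[OF s]
  have int: "integrable \<gamma> (\<lambda>\<theta>. \<theta> ^ j * (1 - \<theta>) ^ d)" for j d
    by (rule \<gamma>.integrable_const_bound[where B = 1])
       (auto simp: sp abs_mult mult_le_one power_le_one intro: unit_interval_measure(2)[OF s])
  have "(LINT \<theta>|\<gamma>. \<theta> ^ j * (1 - \<theta>) ^ d) = weight (j + d) j" for d j
  proof (induction d arbitrary: j)
    case 0
    then show ?case using mom[of j] by (cases "j = 0") (simp_all add: \<gamma>.prob_space weight_0_0)
  next
    case (Suc d)
    have "(LINT \<theta>|\<gamma>. \<theta> ^ j * (1 - \<theta>) ^ Suc d) = (LINT \<theta>|\<gamma>. \<theta> ^ j * (1 - \<theta>) ^ d - \<theta> ^ Suc j * (1 - \<theta>) ^ d)"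
      by (intro Bochner_Integration.integral_cong) (simp_all add: algebra_simps)
    also have "\<dots> = weight (j + d) j - weight (Suc j + d) (Suc j)"
      unfolding Suc.IH[symmetric] by (rule Bochner_Integration.integral_diff[OF int int])
    also have "\<dots> = weight (j + Suc d) j" using weight_rec[of j "j + d"] by simp
    finally show ?case .
  qed
  from this[of j "n - j"] show "j \<le> n \<Longrightarrow> ?thesis" by simp
qed

text \<open>Patterns consisting of ones give the moments; conversely \<open>mixture_weight\<close>
  recovers every pattern from them. The remaining work translates patterns \<open>j\<close> into
  sets of ones.\<close>

lemma is_de_finetti_measure_iff:
  "is_de_finetti_measure M X \<gamma> \<longleftrightarrow> prob_space \<gamma> \<and> sets \<gamma> = sets (restrict_space borel {0..1}) \<and>
     (\<forall>k\<ge>1. (LINT \<theta>|\<gamma>. \<theta> ^ k) = weight k k)"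
proof -
  have ev: "{\<omega> \<in> space M. \<forall>k\<in>{1..n}. X k \<omega> = j k} = {\<omega> \<in> space M. ones {1..n} \<omega> = {k \<in> {1..n}. j k = 1}}"
    and card: "card {k \<in> {1..n}. j k = 1} = (\<Sum>k=1..n. j k)"
    if j: "j \<in> {1..n} \<rightarrow> {0, 1}" for j :: "nat \<Rightarrow> nat" and n
  proof -
    have "X k \<omega> = j k \<longleftrightarrow> (X k \<omega> = 1 \<longleftrightarrow> j k = 1)" if "k \<in> {1..n}" "\<omega> \<in> space M" for k \<omega>
    proof -
      have "j k = 0 \<or> j k = 1" using j that(1) by blast
      moreover have "X k \<omega> = 0 \<or> X k \<omega> = 1" using that by (intro X_values) auto
      ultimately show ?thesis by auto
    qed
    then have a: "(\<forall>k\<in>{1..n}. X k \<omega> = j k) \<longleftrightarrow> (\<forall>k\<in>{1..n}. X k \<omega> = 1 \<longleftrightarrow> j k = 1)" if "\<omega> \<in> space M" for \<omega>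
      using that by blast
    have b: "ones {1..n} \<omega> = {k \<in> {1..n}. j k = 1} \<longleftrightarrow> (\<forall>k\<in>{1..n}. X k \<omega> = 1 \<longleftrightarrow> j k = 1)" for \<omega>
      unfolding ones_def by blast
    show "{\<omega> \<in> space M. \<forall>k\<in>{1..n}. X k \<omega> = j k} = {\<omega> \<in> space M. ones {1..n} \<omega> = {k \<in> {1..n}. j k = 1}}"
      by (rule Collect_cong, rule conj_cong[OF refl]) (simp only: a b)
    have "(\<Sum>k=1..n. j k) = (\<Sum>k=1..n. of_bool (j k = 1))"
    proof (intro sum.cong refl)
      fix k assume "k \<in> {1..n}"
      then have "j k = 0 \<or> j k = 1" using j by blast
      then show "j k = of_bool (j k = 1)" by auto
    qed
    also have "\<dots> = card ({1..n} \<inter> {k. j k = 1})" by (simp add: sum_of_bool_eq)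
    also have "{1..n} \<inter> {k. j k = 1} = {k \<in> {1..n}. j k = 1}" by auto
    finally show "card {k \<in> {1..n}. j k = 1} = (\<Sum>k=1..n. j k)" by simp
  qed
  have pr: "prob {\<omega> \<in> space M. \<forall>k\<in>{1..n}. X k \<omega> = j k} = weight n (\<Sum>k=1..n. j k)" (is "?l j = _")
    and le: "(\<Sum>k=1..n. j k) \<le> n"
    if j: "j \<in> {1..n} \<rightarrow> {0, 1}" for j n
  proof -
    show "?l j = weight n (\<Sum>k=1..n. j k)"
    proof -
      have "{k \<in> {1..n}. j k = 1} \<subseteq> {1..n}" "{1..n} \<subseteq> {1::nat..}" by auto
      from prob_ones[OF finite_atLeastAtMost this(2,1)] show ?thesis
        unfolding ev[OF j] card[OF j, symmetric] card_atLeastAtMost diff_Suc_1 by simp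
    qed
    show "(\<Sum>k=1..n. j k) \<le> n"
    proof -
      have "{k \<in> {1..n}. j k = 1} \<subseteq> {1..n}" by blast
      from card_mono[OF finite_atLeastAtMost this] show ?thesis
        unfolding card[OF j] by simp
    qed
  qed
  show ?thesis
  proof
    assume df: "is_de_finetti_measure M X \<gamma>"
    have "(LINT \<theta>|\<gamma>. \<theta> ^ n) = weight n n" if "n \<ge> 1" for n
    proof -
      have j: "(\<lambda>_. 1) \<in> {1..n} \<rightarrow> {0, 1::nat}" by simp
      have "\<forall>j\<in>{1..n} \<rightarrow> {0, 1}. prob {\<omega> \<in> space M. \<forall>k\<in>{1..n}. X k \<omega> = j k} =
          (LINT \<theta>|\<gamma>. \<theta> ^ (\<Sum>k=1..n. j k) * (1 - \<theta>) ^ (n - (\<Sum>k=1..n. j k)))"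
        using df that unfolding is_de_finetti_measure_def by blast
      from bspec[OF this j] show ?thesis unfolding pr[OF j] by simp
    qed
    then show "prob_space \<gamma> \<and> sets \<gamma> = sets (restrict_space borel {0..1}) \<and>
     (\<forall>k\<ge>1. (LINT \<theta>|\<gamma>. \<theta> ^ k) = weight k k)"
      using df unfolding is_de_finetti_measure_def by blast
  next
    assume "prob_space \<gamma> \<and> sets \<gamma> = sets (restrict_space borel {0..1}) \<and>
     (\<forall>k\<ge>1. (LINT \<theta>|\<gamma>. \<theta> ^ k) = weight k k)"
    then have g: "prob_space \<gamma>" "sets \<gamma> = sets (restrict_space borel {0..1})"
      "\<And>k. k \<ge> 1 \<Longrightarrow> (LINT \<theta>|\<gamma>. \<theta> ^ k) = weight k k" by auto
    show "is_de_finetti_measure M X \<gamma>"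
      unfolding is_de_finetti_measure_def
    proof (intro conjI g allI impI ballI)
      fix n and j :: "nat \<Rightarrow> nat" assume j: "j \<in> {1..n} \<rightarrow> {0, 1}"
      show "prob {\<omega> \<in> space M. \<forall>k\<in>{1..n}. X k \<omega> = j k} =
          (LINT \<theta>|\<gamma>. \<theta> ^ (\<Sum>k=1..n. j k) * (1 - \<theta>) ^ (n - (\<Sum>k=1..n. j k)))"
        unfolding pr[OF j] by (rule mixture_weight[OF g le[OF j], symmetric])
    qed
  qed
qed

section \<open>Existence and uniqueness of the de Finetti measure\<close>

lemma is_de_finetti_measure_unique:
  assumes "is_de_finetti_measure M X \<gamma>" "is_de_finetti_measure M X \<gamma>'"
  shows "\<gamma> = \<gamma>'"
proof (rule unit_interval_moments_unique)
  fix n :: nat assume "n \<ge> 1"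
  then show "(LINT x|\<gamma>. x ^ n) = (LINT x|\<gamma>'. x ^ n)"
    using assms unfolding is_de_finetti_measure_iff by metis
qed (use assms in \<open>unfold is_de_finetti_measure_iff, blast+\<close>)

text \<open>Existence comes from a limit law of the empirical frequencies and uniqueness from the
  moments; together they justify the definite description in
  \<open>de_finetti_measure\<close>.\<close>

theorem de_finetti: "is_de_finetti_measure M X (de_finetti_measure M X)"
proof -
  let ?Y = "\<lambda>n \<omega>. real (card (ones {1..Suc n} \<omega>)) / real (Suc n)"
  have "\<exists>\<gamma>. prob_space \<gamma> \<and> sets \<gamma> = sets (restrict_space borel {0..1}) \<and>
      (\<forall>k. (LINT x|\<gamma>. x ^ k) = weight k k)"
  proof (rule unit_interval_moment_limit[where Y = ?Y])
    fix n
    have "integrable M (?Y n)"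
      by (rule expectation_ones(1)[where h = "\<lambda>B. real (card B) / real (Suc n)"]) auto
    then show "?Y n \<in> borel_measurable M" by simp
    fix \<omega>
    show "?Y n \<omega> \<in> {0..1}"
      using card_mono[OF _ ones_subset, of "{1..Suc n}" \<omega>] by auto
  qed (rule frequency_moments_limit)
  then obtain \<gamma> where \<gamma>: "is_de_finetti_measure M X \<gamma>"
    unfolding is_de_finetti_measure_iff by blast
  then have "\<exists>!\<gamma>. is_de_finetti_measure M X \<gamma>"
    using is_de_finetti_measure_unique by blast
  then show ?thesis
    unfolding de_finetti_measure_def by (rule theI')
qed

lemma de_finetti_measure_eqI: "is_de_finetti_measure M X \<gamma> \<Longrightarrow> de_finetti_measure M X = \<gamma>"
  using de_finetti is_de_finetti_measure_unique by blast

text \<open>A support point other than 0 and 1 gives the open unit interval positive mass, and there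
  the integrand of \<open>mixture_weight\<close> is positive.\<close>

lemma weight_pos:
  assumes nd: "non_deterministic M X" and j: "j \<le> n"
  shows "0 < weight n j"
proof -
  define \<gamma> where "\<gamma> = de_finetti_measure M X"
  have g: "prob_space \<gamma>" "sets \<gamma> = sets (restrict_space borel {0..1})"
      "\<And>k. k \<ge> 1 \<Longrightarrow> (LINT \<theta>|\<gamma>. \<theta> ^ k) = weight k k"
    using de_finetti unfolding is_de_finetti_measure_iff \<gamma>_def by auto
  interpret \<gamma>: prob_space \<gamma> by (rule g)
  note sp = unit_interval_measure(1)[OF g(2)]
  let ?f = "\<lambda>\<theta>::real. \<theta> ^ j * (1 - \<theta>) ^ (n - j)"
  have int: "integrable \<gamma> ?f"
    by (rule \<gamma>.integrable_const_bound[where B = 1])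
       (auto simp: sp abs_mult mult_le_one power_le_one intro: unit_interval_measure(2)[OF g(2)])
  obtain x where x: "x \<in> measure_support \<gamma>" "x \<noteq> 0" "x \<noteq> 1"
    using nd unfolding non_deterministic_def \<gamma>_def by auto
  then have x01: "x \<in> {0<..<1}" unfolding measure_support_def sp by auto
  have pos: "emeasure \<gamma> ({0<..<1} \<inter> space \<gamma>) > 0"
  proof -
    have "emeasure \<gamma> (U \<inter> space \<gamma>) > 0" if "open U" "x \<in> U" for U
      using x(1) that unfolding measure_support_def by blast
    from this[of "{0<..<1}"] x01 show ?thesis by simp
  qed
  have nonneg: "0 \<le> ?f \<theta>" if "\<theta> \<in> space \<gamma>" for \<theta>
    using that unfolding sp by simp
  have "(LINT \<theta>|\<gamma>. ?f \<theta>) \<noteq> 0"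
  proof
    assume "(LINT \<theta>|\<gamma>. ?f \<theta>) = 0"
    then have "AE \<theta> in \<gamma>. ?f \<theta> = 0"
      using integral_nonneg_eq_0_iff_AE[OF int AE_I2[OF nonneg]] by (simp only:)
    then have "AE \<theta> in \<gamma>. \<theta> \<notin> {0<..<1} \<inter> space \<gamma>" by eventually_elim auto
    moreover have "{0<..<1} \<inter> space \<gamma> \<in> sets \<gamma>"
      unfolding g(2) sp by (auto simp: sets_restrict_space_iff)
    ultimately have "emeasure \<gamma> ({0<..<1} \<inter> space \<gamma>) = 0" by (simp add: AE_iff_null_sets null_setsD1)
    then show False using pos by simp
  qed
  moreover have "(LINT \<theta>|\<gamma>. ?f \<theta>) \<ge> 0" by (rule Bochner_Integration.integral_nonneg) (rule nonneg)
  ultimately show ?thesis using mixture_weight[OF g j] by simp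
qed

end

subsection \<open>Hoeffding decomposability\<close>

text \<open>Together with \<open>profile_kernel\<close> this identifies symmetric kernels on
  \<open>cube k\<close> with functions of the number of ones up to \<open>k\<close>.\<close>

definition kernel_profile :: "nat \<Rightarrow> (nat list \<Rightarrow> real) \<Rightarrow> nat \<Rightarrow> real" where
  "kernel_profile k \<phi> i = \<phi> (replicate i 1 @ replicate (k - i) 0)"

definition profile_kernel :: "(nat \<Rightarrow> real) \<Rightarrow> nat list \<Rightarrow> real" where
  "profile_kernel h xs = h (length (filter (\<lambda>x. x = 1) xs))"

lemma mset_binary:
  assumes "set xs \<subseteq> {0, 1::nat}"
  shows "mset xs = replicate_mset (length (filter (\<lambda>x. x = 1) xs)) 1 +
    replicate_mset (length xs - length (filter (\<lambda>x. x = 1) xs)) 0"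
  using assms
proof (induction xs)
  case (Cons x xs)
  then have "x = 0 \<or> x = 1" by auto
  then show ?case
    using Cons length_filter_le[of "\<lambda>x. x = 1" xs] by (auto simp: Suc_diff_le)
qed simp

lemma symmetric_kernel_eq_profile:
  assumes "symmetric_kernel k \<phi>" and xs: "xs \<in> cube k"
  shows "\<phi> xs = kernel_profile k \<phi> (length (filter (\<lambda>x. x = 1) xs))"
proof -
  let ?i = "length (filter (\<lambda>x. x = 1) xs)"
  have i: "?i \<le> k" and len: "length xs = k" "set xs \<subseteq> {0, 1}"
    using xs length_filter_le[of "\<lambda>x. x = 1" xs] by (auto simp: cube_def)
  have "replicate ?i 1 @ replicate (k - ?i) 0 \<in> cube k"
    using i by (auto simp: cube_def)
  moreover have "mset xs = mset (replicate ?i 1 @ replicate (k - ?i) 0)"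
    using mset_binary[OF len(2)] len(1) by simp
  ultimately show ?thesis
    using assms unfolding symmetric_kernel_def kernel_profile_def by blast
qed

lemma symmetric_profile_kernel: "symmetric_kernel k (profile_kernel h)"
  unfolding symmetric_kernel_def profile_kernel_def by (metis mset_filter size_mset)

lemma kernel_profile_profile_kernel: "i \<le> k \<Longrightarrow> kernel_profile k (profile_kernel h) i = h i"
  by (simp add: kernel_profile_def profile_kernel_def)

lemma kernel_subvector:
  assumes \<phi>: "symmetric_kernel k \<phi>" and J: "finite J" "card J = k"
    and X: "\<And>i. i \<in> J \<Longrightarrow> X i \<omega> = 0 \<or> X i \<omega> = (1::nat)"
  shows "\<phi> (subvector X J \<omega>) = kernel_profile k \<phi> (card {i \<in> J. X i \<omega> = 1})"
proof -
  have "subvector X J \<omega> \<in> cube k"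
  proof -
    have "set (subvector X J \<omega>) = (\<lambda>i. X i \<omega>) ` J"
      using J(1) by (simp add: subvector_def)
    also have "\<dots> \<subseteq> {0, 1}"
    proof (rule image_subsetI)
      fix i assume "i \<in> J"
      from X[OF this] show "X i \<omega> \<in> {0, 1}" by auto
    qed
    finally show ?thesis using J by (simp add: cube_def subvector_def)
  qed
  moreover have "length (filter (\<lambda>x. x = 1) (subvector X J \<omega>)) = card {i \<in> J. X i \<omega> = 1}"
  proof -
    have "length (filter (\<lambda>x. x = 1) (subvector X J \<omega>)) = length (filter (\<lambda>i. X i \<omega> = 1) (sorted_list_of_set J))"
      by (simp add: subvector_def filter_map o_def)
    also have "\<dots> = card (set (filter (\<lambda>i. X i \<omega> = 1) (sorted_list_of_set J)))"
      by (rule distinct_card[symmetric]) simp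
    also have "set (filter (\<lambda>i. X i \<omega> = 1) (sorted_list_of_set J)) = {i \<in> J. X i \<omega> = 1}"
      using J by auto
    finally show ?thesis .
  qed
  ultimately show ?thesis
    using symmetric_kernel_eq_profile[OF \<phi>] by simp
qed

lemma U_statistic_eq_kernel_sum:
  assumes \<phi>: "symmetric_kernel k \<phi>"
    and X: "\<And>i. i \<in> {1..n} \<Longrightarrow> X i \<omega> = 0 \<or> X i \<omega> = (1::nat)"
  shows "U_statistic X n k \<phi> \<omega> = kernel_sum n k (kernel_profile k \<phi>) {i \<in> {1..n}. X i \<omega> = 1}"
  unfolding U_statistic_def kernel_sum_def
proof (rule sum.cong[OF refl])
  fix J assume "J \<in> {J. J \<subseteq> {1..n} \<and> card J = k}"
  then have J: "J \<subseteq> {1..n}" "card J = k" by auto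
  then have "finite J" by (meson finite_atLeastAtMost finite_subset)
  then have "\<phi> (subvector X J \<omega>) = kernel_profile k \<phi> (card {i \<in> J. X i \<omega> = 1})"
  proof (intro kernel_subvector[OF \<phi>])
    fix i assume "i \<in> J"
    then show "X i \<omega> = 0 \<or> X i \<omega> = 1" using J(1) by (intro X) blast
  qed (use J in auto)
  also have "{i \<in> J. X i \<omega> = 1} = J \<inter> {i \<in> {1..n}. X i \<omega> = 1}" using J by auto
  finally show "\<phi> (subvector X J \<omega>) = kernel_profile k \<phi> (card (J \<inter> {i \<in> {1..n}. X i \<omega> = 1}))" .
qed

lemma U_statistic_in_Ls:
  assumes \<phi>: "symmetric_kernel k \<phi>"
  shows "U_statistic X n k \<phi> \<in> Ls X n"
proof -
  \<comment> \<open>\<open>T\<close> evaluates the U-statistic on the deterministic sequence stored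
    in the list, over a one-point sample space; the shift \<open>i - 1\<close> is due to lists being
    indexed from 0.\<close>
  define T where "T xs = U_statistic (\<lambda>i _. xs ! (i - 1)) n k \<phi> ()" for xs
  have "T (subvector X {1..n} \<omega>) = U_statistic X n k \<phi> \<omega>" for \<omega>
    unfolding T_def U_statistic_def
  proof (rule sum.cong[OF refl])
    fix J assume "J \<in> {J. J \<subseteq> {1..n} \<and> card J = k}"
    then have J: "J \<subseteq> {1..n}" "finite J" by (auto intro: finite_subset)
    have "sorted_list_of_set {1..n} = [1..<Suc n]"
      by (metis atLeastLessThanSuc_atLeastAtMost sorted_list_of_set_range)
    then have vec: "subvector X {1..n} \<omega> = map (\<lambda>i. X i \<omega>) [1..<Suc n]"
      by (simp only: subvector_def)
    have "subvector X {1..n} \<omega> ! (i - 1) = X i \<omega>" if "i \<in> J" for i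
    proof -
      have "i \<in> {1..n}" using J(1) that by blast
      then show ?thesis unfolding vec by (auto simp del: upt_Suc)
    qed
    then have "subvector (\<lambda>i _. subvector X {1..n} \<omega> ! (i - 1)) J () = subvector X J \<omega>"
      unfolding subvector_def[of _ J] using J(2) by (intro map_cong) auto
    then show "\<phi> (subvector (\<lambda>i _. subvector X {1..n} \<omega> ! (i - 1)) J ()) = \<phi> (subvector X J \<omega>)"
      by simp
  qed
  moreover have "symmetric_kernel n T"
  proof -
    have "T xs = kernel_count n k (kernel_profile k \<phi>) (length (filter (\<lambda>x. x = 1) xs))" if xs: "xs \<in> cube n" for xs
    proof -
      have len: "length xs = n" and set: "set xs \<subseteq> {0, 1}" using xs by (auto simp: cube_def)
      have "xs ! (i - 1) = 0 \<or> xs ! (i - 1) = 1" if "i \<in> {1..n}" for i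
      proof -
        have "xs ! (i - 1) \<in> set xs" using that len by (intro nth_mem) auto
        then have "xs ! (i - 1) \<in> {0, 1}" using set by blast
        then show ?thesis by blast
      qed
      then have "T xs = kernel_sum n k (kernel_profile k \<phi>) {i \<in> {1..n}. xs ! (i - 1) = 1}"
        unfolding T_def by (intro U_statistic_eq_kernel_sum[OF \<phi>])
      also have "\<dots> = kernel_count n k (kernel_profile k \<phi>) (card {i \<in> {1..n}. xs ! (i - 1) = 1})"
        by (rule kernel_sum_eq_count) blast
      also have "{i \<in> {1..n}. xs ! (i - 1) = 1} = Suc ` {i. i < length xs \<and> xs ! i = 1}"
      proof (rule set_eqI)
        fix i
        show "i \<in> {i \<in> {1..n}. xs ! (i - 1) = 1} \<longleftrightarrow> i \<in> Suc ` {i. i < length xs \<and> xs ! i = 1}"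
          by (cases i) (auto simp: len)
      qed
      also have "card \<dots> = length (filter (\<lambda>x. x = 1) xs)"
        by (simp add: card_image length_filter_conv_card)
      finally show ?thesis .
    qed
    then show ?thesis
      unfolding symmetric_kernel_def by (metis mset_filter size_mset)
  qed
  ultimately have "U_statistic X n k \<phi> = (\<lambda>\<omega>. T (subvector X {1..n} \<omega>)) \<and> symmetric_kernel n T"
    by auto
  then show ?thesis unfolding Ls_def by blast
qed

lemma kernel_sum_cong:
  assumes "\<And>i. i \<le> k \<Longrightarrow> f i = g i"
  shows "kernel_sum n k f B = kernel_sum n k g B"
  unfolding kernel_sum_def
proof (rule sum.cong[OF refl])
  fix J assume "J \<in> {J. J \<subseteq> {1..n} \<and> card J = k}"
  then have "finite J" "card J = k" by (auto intro: finite_subset)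
  then have "card (J \<inter> B) \<le> k" using card_mono[of J "J \<inter> B"] by auto
  then show "f (card (J \<inter> B)) = g (card (J \<inter> B))" by (rule assms)
qed

lemma (in binary_weights) degenerate_cong:
  assumes "\<And>i. i \<le> k \<Longrightarrow> f i = g i"
  shows "degenerate k f \<longleftrightarrow> degenerate k g"
  unfolding degenerate_def using assms by (auto simp: Suc_le_eq less_imp_le)

lemma (in binary_weights) orth_cong:
  assumes "\<And>i. i \<le> k \<Longrightarrow> f i = g i"
  shows "orth n k f \<longleftrightarrow> orth n k g"
proof -
  have "kernel_sum n k f B = kernel_sum n k g B" for B
    by (rule kernel_sum_cong) (rule assms)
  then show ?thesis unfolding orth_def by simp
qed

locale nondeterministic_binary = exchangeable_binary +
  assumes nondet: "non_deterministic M X"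
begin

sublocale binary_weights weight
  by unfold_locales (fact weight_rec weight_pos[OF nondet] weight_0_0)+

section \<open>Orthogonality and conditioning in terms of kernel profiles\<close>

lemma integral_U_statistics:
  assumes "symmetric_kernel k \<phi>" "symmetric_kernel l \<psi>"
  shows "(LINT \<omega>|M. U_statistic X n k \<phi> \<omega> * U_statistic X n l \<psi> \<omega>) =
    (\<Sum>B\<in>Pow {1..n}. weight n (card B) *
       (kernel_sum n k (kernel_profile k \<phi>) B * kernel_sum n l (kernel_profile l \<psi>) B))"
proof -
  have "(LINT \<omega>|M. U_statistic X n k \<phi> \<omega> * U_statistic X n l \<psi> \<omega>) =
    expectation (\<lambda>\<omega>. kernel_sum n k (kernel_profile k \<phi>) (ones {1..n} \<omega>) *
       kernel_sum n l (kernel_profile l \<psi>) (ones {1..n} \<omega>))"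
  proof (rule Bochner_Integration.integral_cong[OF refl])
    fix \<omega> assume "\<omega> \<in> space M"
    then have X: "X i \<omega> = 0 \<or> X i \<omega> = 1" if "i \<in> {1..n}" for i using X_values that by auto
    show "U_statistic X n k \<phi> \<omega> * U_statistic X n l \<psi> \<omega> =
      kernel_sum n k (kernel_profile k \<phi>) (ones {1..n} \<omega>) *
       kernel_sum n l (kernel_profile l \<psi>) (ones {1..n} \<omega>)"
      unfolding ones_def
      using U_statistic_eq_kernel_sum[where X = X and \<omega> = \<omega>, OF assms(1) X]
        U_statistic_eq_kernel_sum[where X = X and \<omega> = \<omega>, OF assms(2) X] by (simp only:)
  qed
  also have "\<dots> = (\<Sum>B\<in>Pow {1..n}. weight (card {1..n}) (card B) *
       (kernel_sum n k (kernel_profile k \<phi>) B * kernel_sum n l (kernel_profile l \<psi>) B))"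
    by (rule expectation_ones(2)) auto
  finally show ?thesis by simp
qed

lemma U_statistic_in_SH_iff:
  assumes \<phi>: "symmetric_kernel k \<phi>"
  shows "U_statistic X n k \<phi> \<in> SH M X n k \<longleftrightarrow> orth n k (kernel_profile k \<phi>)"
proof -
  have "U_statistic X n k \<phi> \<in> SH M X n k \<longleftrightarrow>
    (\<forall>\<psi>. symmetric_kernel (k - 1) \<psi> \<longrightarrow>
       (LINT \<omega>|M. U_statistic X n k \<phi> \<omega> * U_statistic X n (k - 1) \<psi> \<omega>) = 0)"
    using U_statistic_in_Ls[OF \<phi>, of X n] \<phi> unfolding SH_def SU_def orthogonal_in_Ls_def by blast
  also have "\<dots> \<longleftrightarrow> orth n k (kernel_profile k \<phi>)"
    unfolding orth_def
  proof (intro iffI allI impI)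
    fix h
    assume *: "\<forall>\<psi>. symmetric_kernel (k - 1) \<psi> \<longrightarrow>
       (LINT \<omega>|M. U_statistic X n k \<phi> \<omega> * U_statistic X n (k - 1) \<psi> \<omega>) = 0"
    have "kernel_sum n (k - 1) (kernel_profile (k - 1) (profile_kernel h)) B = kernel_sum n (k - 1) h B" for B
      by (rule kernel_sum_cong) (rule kernel_profile_profile_kernel)
    then show "(\<Sum>B\<in>Pow {1..n}. weight n (card B) *
        (kernel_sum n k (kernel_profile k \<phi>) B * kernel_sum n (k - 1) h B)) = 0"
      using *[rule_format, OF symmetric_profile_kernel[of "k - 1" h]]
      unfolding integral_U_statistics[OF \<phi> symmetric_profile_kernel] by (simp only:)
  next
    fix \<psi> assume *: "\<forall>h. (\<Sum>B\<in>Pow {1..n}. weight n (card B) *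
        (kernel_sum n k (kernel_profile k \<phi>) B * kernel_sum n (k - 1) h B)) = 0"
      and \<psi>: "symmetric_kernel (k - 1) \<psi>"
    show "(LINT \<omega>|M. U_statistic X n k \<phi> \<omega> * U_statistic X n (k - 1) \<psi> \<omega>) = 0"
      unfolding integral_U_statistics[OF \<phi> \<psi>] using * by blast
  qed
  finally show ?thesis .
qed

text \<open>A finite product of two-point spaces is discrete, so every set of outcomes on
  \<open>I\<close> is available.\<close>

lemma sets_generated_algebra:
  assumes I: "finite I" "I \<subseteq> {1..}"
  shows "sets (generated_algebra M X I) = {{\<omega> \<in> space M. ones I \<omega> \<in> \<B>} | \<B>. True}"
proof -
  define P where "P = (\<Pi>\<^sub>M i\<in>I. bin)"
  define f where "f \<omega> = (\<lambda>i\<in>I. X i \<omega>)" for \<omega>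
  have P_eq: "P = count_space (\<Pi>\<^sub>E i\<in>I. {0, 1})"
    unfolding P_def using I(1) by (intro count_space_PiM_finite) auto
  have f: "f \<omega> \<in> (\<Pi>\<^sub>E i\<in>I. {0, 1})" if "\<omega> \<in> space M" for \<omega>
  proof -
    have "\<forall>i\<in>I. X i \<omega> \<in> {0, 1}"
    proof
      fix i assume "i \<in> I"
      then have "i \<ge> 1" using I(2) by auto
      from X_values[OF this that] show "X i \<omega> \<in> {0, 1}" by blast
    qed
    then show ?thesis by (simp only: f_def restrict_PiE_iff)
  qed
  have sets: "sets (generated_algebra M X I) = {f -` S \<inter> space M | S. S \<in> sets P}"
    unfolding generated_algebra_def P_def[symmetric] f_def[symmetric]
    using f by (intro sets_vimage_algebra2) (auto simp: P_eq)
  have ones_f: "ones I \<omega> = {i \<in> I. f \<omega> i = 1}" for \<omega>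
    by (auto simp: ones_def f_def)
  have f_ones: "f \<omega> = (\<lambda>i\<in>I. if i \<in> ones I \<omega> then 1 else 0)" if "\<omega> \<in> space M" for \<omega>
  proof
    fix i
    show "f \<omega> i = (\<lambda>i\<in>I. if i \<in> ones I \<omega> then 1 else 0) i"
      using X_values[OF _ that, of i] I(2) by (auto simp: f_def ones_def)
  qed
  show ?thesis
    unfolding sets
  proof (intro set_eqI iffI)
    fix A assume "A \<in> {f -` S \<inter> space M | S. S \<in> sets P}"
    then obtain S where A: "A = f -` S \<inter> space M" by blast
    have "A = {\<omega> \<in> space M. ones I \<omega> \<in> {B. (\<lambda>i\<in>I. if i \<in> B then 1 else 0) \<in> S}}"
      unfolding A using f_ones by auto
    then show "A \<in> {{\<omega> \<in> space M. ones I \<omega> \<in> \<B>} | \<B>. True}" by blast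
  next
    fix A assume "A \<in> {{\<omega> \<in> space M. ones I \<omega> \<in> \<B>} | \<B>. True}"
    then obtain \<B> where A: "A = {\<omega> \<in> space M. ones I \<omega> \<in> \<B>}" by blast
    define S where "S = {x \<in> (\<Pi>\<^sub>E i\<in>I. {0, 1::nat}). {i \<in> I. x i = 1} \<in> \<B>}"
    have "A = f -` S \<inter> space M"
      unfolding A S_def ones_f using f by blast
    moreover have "S \<in> sets P" unfolding P_eq S_def by auto
    ultimately show "A \<in> {f -` S \<inter> space M | S. S \<in> sets P}" by blast
  qed
qed

lemma subalgebra_generated_algebra:
  assumes I: "finite I" "I \<subseteq> {1..}"
  shows "subalgebra M (generated_algebra M X I)"
proof -
  have "{\<omega> \<in> space M. ones I \<omega> \<in> \<B>} \<in> events" for \<B>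
  proof -
    have "{\<omega> \<in> space M. ones I \<omega> \<in> \<B>} = (\<Union>B\<in>\<B> \<inter> Pow I. {\<omega> \<in> space M. ones I \<omega> = B})"
      using ones_subset by auto
    also have "\<dots> \<in> events"
      using I event_ones[OF I] by (intro sets.finite_UN) auto
    finally show ?thesis .
  qed
  then show ?thesis
    unfolding subalgebra_def sets_generated_algebra[OF I] by (auto simp: generated_algebra_def)
qed

text \<open>The conditional expectation vanishes exactly if \<phi> integrates to 0 over every atom
  of the conditioning algebra. On an atom with \<open>j\<close> ones among
  \<open>X_2, ..., X_k\<close>, splitting by \<open>X_1\<close> gives the expression in
  \<open>degenerate\<close>.\<close>

lemma cond_exp_zero_iff_degenerate:
  assumes \<phi>: "symmetric_kernel k \<phi>" and k: "1 \<le> k"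
  shows "(AE \<omega> in M. real_cond_exp M (generated_algebra M X {2..k})
             (\<lambda>\<omega>. \<phi> (subvector X {1..k} \<omega>)) \<omega> = 0) \<longleftrightarrow> degenerate k (kernel_profile k \<phi>)"
proof -
  define F where "F = (\<lambda>\<omega>. \<phi> (subvector X {1..k} \<omega>))"
  define r where "r = kernel_profile k \<phi>"
  let ?G = "generated_algebra M X {2..k}"
  have I: "finite {2..k}" "{2..k} \<subseteq> {1::nat..}" and K: "finite {1..k}" "{1..k} \<subseteq> {1::nat..}" by auto
  interpret G: finite_measure_subalgebra M ?G
    using subalgebra_generated_algebra[OF I] by unfold_locales
  have F: "F \<omega> = r (card (ones {1..k} \<omega>))" if "\<omega> \<in> space M" for \<omega>
    unfolding F_def r_def ones_def using X_values that by (intro kernel_subvector[OF \<phi>]) auto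
  have intF: "integrable M F"
    using expectation_ones(1)[OF K, of "\<lambda>B. r (card B)"] F
    by (subst Bochner_Integration.integrable_cong[OF refl F]) auto
  have ins: "{1..k} = insert 1 {2..k}" using k by auto
  have int: "(LINT \<omega>:{\<omega> \<in> space M. ones {2..k} \<omega> \<in> \<B>}|M. F \<omega>) =
      (\<Sum>C\<in>Pow {2..k}. of_bool (C \<in> \<B>) * (r (card C) * weight k (card C) + r (Suc (card C)) * weight k (Suc (card C))))"
    for \<B>
  proof -
    have "(LINT \<omega>:{\<omega> \<in> space M. ones {2..k} \<omega> \<in> \<B>}|M. F \<omega>) =
       expectation (\<lambda>\<omega>. of_bool (ones {1..k} \<omega> \<inter> {2..k} \<in> \<B>) * r (card (ones {1..k} \<omega>)))"
      unfolding set_lebesgue_integral_def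
    proof (rule Bochner_Integration.integral_cong[OF refl])
      fix \<omega> assume \<omega>: "\<omega> \<in> space M"
      have "ones {1..k} \<omega> \<inter> {2..k} = ones {2..k} \<omega>" by (auto simp: ones_def)
      then show "indicat_real {\<omega> \<in> space M. ones {2..k} \<omega> \<in> \<B>} \<omega> *\<^sub>R F \<omega> =
          of_bool (ones {1..k} \<omega> \<inter> {2..k} \<in> \<B>) * r (card (ones {1..k} \<omega>))"
        using F[OF \<omega>] \<omega> by (simp add: indicator_def)
    qed
    also have "\<dots> = (\<Sum>B\<in>Pow {1..k}. weight (card {1..k}) (card B) * (of_bool (B \<inter> {2..k} \<in> \<B>) * r (card B)))"
      by (rule expectation_ones(2)[OF K])
    also have "\<dots> = (\<Sum>B\<in>Pow (insert 1 {2..k}). weight k (card B) * (of_bool (B \<inter> {2..k} \<in> \<B>) * r (card B)))"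
      unfolding ins[symmetric] by simp
    also have "\<dots> = (\<Sum>C\<in>Pow {2..k}. weight k (card C) * (of_bool (C \<inter> {2..k} \<in> \<B>) * r (card C)) +
        weight k (card (insert 1 C)) * (of_bool (insert 1 C \<inter> {2..k} \<in> \<B>) * r (card (insert 1 C))))"
      by (rule sum_Pow_insert) auto
    also have "\<dots> = (\<Sum>C\<in>Pow {2..k}. of_bool (C \<in> \<B>) * (r (card C) * weight k (card C) + r (Suc (card C)) * weight k (Suc (card C))))"
    proof (rule sum.cong[OF refl])
      fix C assume "C \<in> Pow {2..k}"
      then have C: "C \<subseteq> {2..k}" by blast
      then have "finite C" "1 \<notin> C" by (auto intro: finite_subset)
      then have "card (insert 1 C) = Suc (card C)" by simp
      moreover have "C \<inter> {2..k} = C" "insert 1 C \<inter> {2..k} = C" using C by auto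
      ultimately show "weight k (card C) * (of_bool (C \<inter> {2..k} \<in> \<B>) * r (card C)) +
        weight k (card (insert 1 C)) * (of_bool (insert 1 C \<inter> {2..k} \<in> \<B>) * r (card (insert 1 C))) =
        of_bool (C \<in> \<B>) * (r (card C) * weight k (card C) + r (Suc (card C)) * weight k (Suc (card C)))"
        by (simp only:) (simp only: algebra_simps)
    qed
    finally show ?thesis .
  qed
  show ?thesis
    unfolding F_def[symmetric] r_def[symmetric]
  proof
    assume ae: "AE \<omega> in M. real_cond_exp M ?G F \<omega> = 0"
    show "degenerate k r"
      unfolding degenerate_def
    proof (intro allI impI)
      fix j assume j: "j < k"
      \<comment> \<open>An atom with \<open>j\<close> ones in the leading positions;
        \<open>j < k\<close> ensures that they fit into \<open>{2..k}\<close>.\<close>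
      let ?A = "{\<omega> \<in> space M. ones {2..k} \<omega> \<in> {{2..Suc j}}}"
      have A: "?A \<in> sets ?G" unfolding sets_generated_algebra[OF I] by blast
      have "(LINT \<omega>:?A|M. F \<omega>) = (LINT \<omega>:?A|M. real_cond_exp M ?G F \<omega>)"
        by (rule G.real_cond_exp_intA[OF intF A])
      also have "\<dots> = 0"
        unfolding set_lebesgue_integral_def
      proof (rule integral_eq_zero_AE)
        show "AE \<omega> in M. indicat_real ?A \<omega> *\<^sub>R real_cond_exp M ?G F \<omega> = 0"
          using ae by eventually_elim simp
      qed
      finally have "0 = (\<Sum>C\<in>Pow {2..k}. of_bool (C \<in> {{2..Suc j}}) *
          (r (card C) * weight k (card C) + r (Suc (card C)) * weight k (Suc (card C))))"
        unfolding int ..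
      also have "\<dots> = (\<Sum>C\<in>{{2..Suc j}}. of_bool (C \<in> {{2..Suc j}}) *
          (r (card C) * weight k (card C) + r (Suc (card C)) * weight k (Suc (card C))))"
        by (rule sum.mono_neutral_right) (use j in auto)
      finally show "r j * weight k j + r (Suc j) * weight k (Suc j) = 0" by simp
    qed
  next
    assume deg: "degenerate k r"
    show "AE \<omega> in M. real_cond_exp M ?G F \<omega> = 0"
    proof (rule G.real_cond_exp_charact)
      fix A assume "A \<in> sets ?G"
      then obtain \<B> where A: "A = {\<omega> \<in> space M. ones {2..k} \<omega> \<in> \<B>}"
        unfolding sets_generated_algebra[OF I] by blast
      have "(LINT \<omega>:A|M. F \<omega>) = 0"
        unfolding A int
      proof (rule sum.neutral, rule ballI)
        fix C assume "C \<in> Pow {2..k}"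
        then have "card C \<le> card {2..k}" by (intro card_mono) auto
        then have "card C < k" using k by simp
        then show "of_bool (C \<in> \<B>) * (r (card C) * weight k (card C) + r (Suc (card C)) * weight k (Suc (card C))) = 0"
          using deg unfolding degenerate_def by simp
      qed
      then show "(LINT \<omega>:A|M. F \<omega>) = (LINT \<omega>:A|M. 0)" by simp
    qed (use intF in auto)
  qed
qed

lemma hoeffding_decomposable_iff: "hoeffding_decomposable M X \<longleftrightarrow> affine_prediction"
proof -
  have "hoeffding_decomposable M X \<longleftrightarrow>
    (\<forall>n\<ge>2. \<forall>k\<in>{1..n}. \<forall>\<phi>. symmetric_kernel k \<phi> \<longrightarrow>
      (orth n k (kernel_profile k \<phi>) \<longleftrightarrow> degenerate k (kernel_profile k \<phi>)))"
    unfolding hoeffding_decomposable_def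
    by (auto simp: U_statistic_in_SH_iff cond_exp_zero_iff_degenerate simp del: One_nat_def)
  also have "\<dots> \<longleftrightarrow> (\<forall>n\<ge>2. \<forall>k\<in>{1..n}. \<forall>h. orth n k h \<longleftrightarrow> degenerate k h)"
  proof (rule iffI, intro allI impI ballI)
    fix n k :: nat and h
    assume *: "\<forall>n\<ge>2. \<forall>k\<in>{1..n}. \<forall>\<phi>. symmetric_kernel k \<phi> \<longrightarrow>
      (orth n k (kernel_profile k \<phi>) \<longleftrightarrow> degenerate k (kernel_profile k \<phi>))" "2 \<le> n" "k \<in> {1..n}"
    then have "orth n k (kernel_profile k (profile_kernel h)) \<longleftrightarrow> degenerate k (kernel_profile k (profile_kernel h))"
      using symmetric_profile_kernel by blast
    then show "orth n k h \<longleftrightarrow> degenerate k h"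
      using orth_cong[of k "kernel_profile k (profile_kernel h)" h n, OF kernel_profile_profile_kernel]
        degenerate_cong[of k "kernel_profile k (profile_kernel h)" h, OF kernel_profile_profile_kernel]
      by blast
  qed blast
  finally show ?thesis unfolding affine_prediction_iff_orth .
qed

section \<open>Independence in terms of pattern probabilities\<close>

lemma prob_X:
  assumes "i \<ge> 1"
  shows "prob (X i -` {1} \<inter> space M) = weight 1 1" "prob (X i -` {0} \<inter> space M) = 1 - weight 1 1"
proof -
  have "X i -` {1} \<inter> space M = {\<omega> \<in> space M. ones {i} \<omega> = {i}}"
    by (auto simp: ones_def)
  then show 1: "prob (X i -` {1} \<inter> space M) = weight 1 1"
    using prob_ones[of "{i}" "{i}"] assms by simp
  have "X i -` {0} \<inter> space M = space M - (X i -` {1} \<inter> space M)"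
    using X_values[OF assms] by auto
  moreover have "X i -` {1} \<inter> space M \<in> events"
    using X_meas[OF assms] by (rule measurable_sets) simp
  ultimately show "prob (X i -` {0} \<inter> space M) = 1 - weight 1 1"
    using prob_compl 1 by metis
qed

lemma iid_sequence_imp_weights:
  assumes iid: "iid_sequence M X"
  shows iid_weights
proof -
  define a where "a = weight 1 1"
  have "weight n j = a ^ j * (1 - a) ^ (n - j)" if j: "j \<le> n" for n j
  proof (cases "n = 0")
    case True
    then show ?thesis using j weight_0_0 by simp
  next
    case False
    define A where "A i = (if i \<le> j then {1} else {0::nat})" for i
    have "{\<omega> \<in> space M. ones {1..n} \<omega> = {1..j}} = (\<Inter>i\<in>{1..n}. X i -` A i \<inter> space M)"
    proof (intro set_eqI iffI)
      fix \<omega> assume "\<omega> \<in> {\<omega> \<in> space M. ones {1..n} \<omega> = {1..j}}"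
      then have \<omega>: "\<omega> \<in> space M" and o: "ones {1..n} \<omega> = {1..j}" by auto
      have "X i \<omega> \<in> A i" if "i \<in> {1..n}" for i
      proof -
        have "i \<in> ones {1..n} \<omega> \<longleftrightarrow> i \<in> {1..j}" by (simp only: o)
        then have "X i \<omega> = 1 \<longleftrightarrow> i \<le> j" using that by (simp add: ones_def)
        moreover have "X i \<omega> = 0 \<or> X i \<omega> = 1" using X_values \<omega> that by auto
        ultimately show ?thesis by (auto simp: A_def)
      qed
      then show "\<omega> \<in> (\<Inter>i\<in>{1..n}. X i -` A i \<inter> space M)" using \<omega> by auto
    next
      fix \<omega> assume *: "\<omega> \<in> (\<Inter>i\<in>{1..n}. X i -` A i \<inter> space M)"
      then have \<omega>: "\<omega> \<in> space M" using False by (auto dest: bspec[of _ _ 1])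
      have "X i \<omega> = 1 \<longleftrightarrow> i \<le> j" if "i \<in> {1..n}" for i
        using * that by (auto simp: A_def split: if_splits)
      then have "ones {1..n} \<omega> = {1..j}" using j by (auto simp: ones_def)
      with \<omega> show "\<omega> \<in> {\<omega> \<in> space M. ones {1..n} \<omega> = {1..j}}" by blast
    qed
    then have "weight n j = prob (\<Inter>i\<in>{1..n}. X i -` A i \<inter> space M)"
      by (simp only: weight_def)
    also have "\<dots> = (\<Prod>i\<in>{1..n}. prob (X i -` A i \<inter> space M))"
      using iid False unfolding iid_sequence_def by (intro indep_varsD[where I = "{1..}"]) (auto simp: A_def)
    also have "\<dots> = (\<Prod>i\<in>{1..n}. if i \<le> j then a else 1 - a)"
      by (intro prod.cong refl) (auto simp: A_def a_def prob_X simp del: One_nat_def)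
    also have "\<dots> = a ^ card {1..j} * (1 - a) ^ card {Suc j..n}"
    proof -
      have "{1..n} \<inter> {i. i \<le> j} = {1..j}" "{1..n} \<inter> - {i. i \<le> j} = {Suc j..n}" using j by auto
      then show ?thesis by (simp add: prod.If_cases)
    qed
    finally show ?thesis by simp
  qed
  then show ?thesis unfolding iid_weights_def by blast
qed

text \<open>A binary variable generates the same sigma-algebra as the event \<open>E i\<close>. A
  single event is stable under intersection, so independence of these events suffices, and this is
  the product form of \<open>weight k k\<close>.\<close>

lemma iid_weights_imp_sequence:
  assumes iid_weights
  shows "iid_sequence M X"
proof -
  obtain a where a: "\<And>n j. j \<le> n \<Longrightarrow> weight n j = a ^ j * (1 - a) ^ (n - j)"
    using assms unfolding iid_weights_def by blast
  define E where "E i = X i -` {1} \<inter> space M" for i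
  have E: "E i \<in> events" if "i \<ge> 1" for i
    unfolding E_def using X_meas[OF that] by (rule measurable_sets) simp
  have prob_E: "prob (E i) = a" if "i \<ge> 1" for i
    using prob_X(1)[OF that] a[of 1 1] unfolding E_def by simp
  have "indep_sets (\<lambda>i. {E i}) {1..}"
  proof (rule indep_setsI)
    fix A J assume J: "J \<noteq> {}" "J \<subseteq> {1..}" "finite J" and A: "\<forall>j\<in>J. A j \<in> {E j}"
    have "(\<Inter>j\<in>J. A j) = (\<Inter>j\<in>J. E j)" using A by auto
    also have "\<dots> = {\<omega> \<in> space M. ones J \<omega> = J}"
      using J(1) by (auto simp: E_def ones_def)
    finally have "prob (\<Inter>j\<in>J. A j) = weight (card J) (card J)"
      using prob_ones[OF J(3,2), of J] by simp
    also have "\<dots> = (\<Prod>j\<in>J. a)" using a by simp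
    also have "\<dots> = (\<Prod>j\<in>J. prob (A j))"
      using A J prob_E by (intro prod.cong) auto
    finally show "prob (\<Inter>j\<in>J. A j) = (\<Prod>j\<in>J. prob (A j))" .
  qed (use E in auto)
  then have "indep_sets (\<lambda>i. sigma_sets (space M) {E i}) {1..}"
    by (rule indep_sets_sigma) (auto simp: Int_stable_def)
  then have "indep_sets (\<lambda>i. sigma_sets (space M) {X i -` A \<inter> space M | A. A \<in> sets bin}) {1..}"
  proof (rule indep_sets_mono_sets)
    fix i :: nat assume "i \<in> {1..}"
    then have i: "i \<ge> 1" by simp
    have "X i -` A \<inter> space M \<in> sigma_sets (space M) {E i}" if "A \<in> sets bin" for A
    proof -
      have "A \<subseteq> {0, 1}" using that by simp
      then consider "A = {}" | "A = {0}" | "A = {1}" | "A = {0, 1}" by (metis subset_insert_iff subset_singletonD insert_Diff_single insert_absorb)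
      then show ?thesis
      proof cases
        case 1
        then show ?thesis by (simp add: sigma_sets.Empty)
      next
        case 2
        then have "X i -` A \<inter> space M = space M - E i"
          using X_values[OF i] by (auto simp: E_def)
        then show ?thesis by (simp add: sigma_sets.Compl sigma_sets.Basic)
      next
        case 3
        then show ?thesis by (auto simp: E_def intro: sigma_sets.Basic)
      next
        case 4
        then have "X i -` A \<inter> space M = space M"
          using X_values[OF i] by auto
        then show ?thesis by (simp add: sigma_sets_top)
      qed
    qed
    then show "sigma_sets (space M) {X i -` A \<inter> space M | A. A \<in> sets bin} \<subseteq> sigma_sets (space M) {E i}"
      by (intro sigma_sets_mono) auto
  qed
  then have "indep_vars (\<lambda>_. bin) X {1..}"
    unfolding indep_vars_def using X_meas by auto
  moreover have "distr M bin (X n) = distr M bin (X 1)" if n: "n \<ge> 1" for n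
  proof (rule measure_eqI_finite)
    fix x :: nat assume "x \<in> {0, 1}"
    then have "prob (X n -` {x} \<inter> space M) = prob (X 1 -` {x} \<inter> space M)"
      using prob_X[OF n] prob_X[of 1] by auto
    then show "emeasure (distr M bin (X n)) {x} = emeasure (distr M bin (X 1)) {x}"
      using X_meas[OF n] X_meas[of 1] \<open>x \<in> {0, 1}\<close> by (simp add: emeasure_distr emeasure_eq_measure del: One_nat_def)
  qed auto
  ultimately show ?thesis unfolding iid_sequence_def by blast
qed

end

subsection \<open>Beta laws and the main equivalence\<close>

lemma Beta_density_moments:
  fixes \<alpha> \<beta> :: real
  assumes "0 < \<alpha>" "0 < \<beta>"
  defines "\<gamma> \<equiv> density (restrict_space lborel {0..1})
          (\<lambda>\<theta>. ennreal (1 / Beta \<alpha> \<beta> * \<theta> powr (\<alpha> - 1) * (1 - \<theta>) powr (\<beta> - 1)))"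
  shows "prob_space \<gamma>" "sets \<gamma> = sets (restrict_space borel {0..1})"
    and "(LINT \<theta>|\<gamma>. \<theta> ^ k) = Beta (\<alpha> + real k) \<beta> / Beta \<alpha> \<beta>"
proof -
  let ?R = "restrict_space lborel {0..1::real}"
  define f where "f \<theta> = 1 / Beta \<alpha> \<beta> * \<theta> powr (\<alpha> - 1) * (1 - \<theta>) powr (\<beta> - 1)" for \<theta>
  have B: "Beta \<alpha> \<beta> > 0" using assms by (intro Beta_real_pos)
  have f_meas: "f \<in> borel_measurable lborel" unfolding f_def by measurable
  then have f_R: "f \<in> borel_measurable ?R" by (rule measurable_restrict_space1)
  have f_nonneg: "0 \<le> f \<theta>" for \<theta> using B by (simp add: f_def)
  have \<gamma>: "\<gamma> = density ?R (\<lambda>\<theta>. ennreal (f \<theta>))" unfolding \<gamma>_def f_def ..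
  show "sets \<gamma> = sets (restrict_space borel {0..1})"
    unfolding \<gamma> by (simp add: sets_restrict_space)
  \<comment> \<open>For positive \<theta> the exponents add up. At 0 both sides vanish because
    \<open>0 powr x\<close> is 0, and below 0 the indicator does.\<close>
  have eq: "indicator {0..1} \<theta> *\<^sub>R (f \<theta> * \<theta> ^ k) =
      1 / Beta \<alpha> \<beta> * (indicator {0..1} \<theta> *\<^sub>R (\<theta> powr (\<alpha> + real k - 1) * (1 - \<theta>) powr (\<beta> - 1)))" for \<theta> k
  proof (cases "0 < \<theta>")
    case True
    have "\<theta> powr (\<alpha> + real k - 1) = \<theta> powr (\<alpha> - 1) * \<theta> ^ k"
      using True by (simp add: powr_realpow[symmetric] flip: powr_add) (simp add: algebra_simps)
    then show ?thesis by (simp add: f_def)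
  next
    case False
    then show ?thesis by (cases "\<theta> = 0") (auto simp: f_def)
  qed
  have int0: "integrable lborel (\<lambda>\<theta>. indicator {0..1} \<theta> *\<^sub>R (f \<theta> * \<theta> ^ k))"
    and val0: "(LINT \<theta>|lborel. indicator {0..1} \<theta> *\<^sub>R (f \<theta> * \<theta> ^ k)) = Beta (\<alpha> + real k) \<beta> / Beta \<alpha> \<beta>" for k
  proof -
    have pos: "\<alpha> + real k > 0" using assms by simp
    have I: "set_integrable lborel {0..1} (\<lambda>\<theta>. \<theta> powr (\<alpha> + real k - 1) * (1 - \<theta>) powr (\<beta> - 1))"
      using integrable_Beta[OF pos assms(2)] .
    then show "integrable lborel (\<lambda>\<theta>. indicator {0..1} \<theta> *\<^sub>R (f \<theta> * \<theta> ^ k))"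
      unfolding eq set_integrable_def by (rule integrable_mult_right)
    have "(LINT \<theta>:{0..1}|lborel. \<theta> powr (\<alpha> + real k - 1) * (1 - \<theta>) powr (\<beta> - 1)) = Beta (\<alpha> + real k) \<beta>"
      unfolding set_borel_integral_eq_integral(2)[OF I]
      using has_integral_Beta_real[OF pos assms(2)] by (rule integral_unique)
    then show "(LINT \<theta>|lborel. indicator {0..1} \<theta> *\<^sub>R (f \<theta> * \<theta> ^ k)) = Beta (\<alpha> + real k) \<beta> / Beta \<alpha> \<beta>"
      unfolding eq set_lebesgue_integral_def integral_mult_right_zero by simp
  qed
  have int: "integrable ?R (\<lambda>\<theta>. f \<theta> * \<theta> ^ k)" for k
    using int0 by (subst integrable_restrict_space) auto
  have val: "(LINT \<theta>|?R. f \<theta> * \<theta> ^ k) = Beta (\<alpha> + real k) \<beta> / Beta \<alpha> \<beta>" for k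
    using val0 by (subst integral_restrict_space) auto
  have "(LINT \<theta>|\<gamma>. \<theta> ^ k) = (LINT \<theta>|?R. f \<theta> *\<^sub>R \<theta> ^ k)"
    unfolding \<gamma>
  proof (rule integral_density)
    show "(\<lambda>\<theta>. \<theta> ^ k) \<in> borel_measurable ?R"
      by (rule measurable_restrict_space1) simp
  qed (use f_R f_nonneg in auto)
  then show "(LINT \<theta>|\<gamma>. \<theta> ^ k) = Beta (\<alpha> + real k) \<beta> / Beta \<alpha> \<beta>" using val by simp
  show "prob_space \<gamma>"
  proof
    have "emeasure \<gamma> (space ?R) = (\<integral>\<^sup>+\<theta>. ennreal (f \<theta>) * indicator (space ?R) \<theta> \<partial>?R)"
      unfolding \<gamma> using f_R by (intro emeasure_density sets.top) simp
    also have "\<dots> = (\<integral>\<^sup>+\<theta>. ennreal (f \<theta>) \<partial>?R)"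
      by (intro nn_integral_cong) simp
    also have "\<dots> = ennreal (LINT \<theta>|?R. f \<theta>)"
      using int[of 0] f_nonneg by (intro nn_integral_eq_integral) auto
    also have "(LINT \<theta>|?R. f \<theta>) = 1" using val[of 0] B by simp
    finally show "emeasure \<gamma> (space \<gamma>) = 1" by (simp add: \<gamma>)
  qed
qed

section \<open>Polya sequences in terms of pattern probabilities\<close>

context binary_weights
begin

text \<open>Induction on the number of zeros as in \<open>mixture_weight\<close>: the additive
  relation \<open>Beta_real_plus1_plus1\<close> matches \<open>p_rec\<close>.\<close>

lemma beta_weights_iff_moments:
  assumes "0 < \<alpha>" "0 < \<beta>"
  shows "beta_weights \<alpha> \<beta> \<longleftrightarrow> (\<forall>k\<ge>1. p k k = Beta (\<alpha> + real k) \<beta> / Beta \<alpha> \<beta>)"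
proof
  assume mom: "\<forall>k\<ge>1. p k k = Beta (\<alpha> + real k) \<beta> / Beta \<alpha> \<beta>"
  have B: "Beta \<alpha> \<beta> > 0" using assms by (rule Beta_real_pos)
  have "p (j + d) j = Beta (\<alpha> + real j) (\<beta> + real d) / Beta \<alpha> \<beta>" for j d
  proof (induction d arbitrary: j)
    case 0
    then show ?case using mom B p_00 by (cases "j = 0") auto
  next
    case (Suc d)
    have pos: "\<alpha> + real j > 0" "\<beta> + real d > 0" using assms by auto
    have "p (j + Suc d) j = p (j + d) j - p (Suc j + d) (Suc j)"
      using p_rec[of j "j + d"] by simp
    also have "\<dots> = (Beta (\<alpha> + real j) (\<beta> + real d) - Beta (\<alpha> + real j + 1) (\<beta> + real d)) / Beta \<alpha> \<beta>"
      unfolding Suc.IH by (simp add: diff_divide_distrib ac_simps)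
    also have "Beta (\<alpha> + real j) (\<beta> + real d) - Beta (\<alpha> + real j + 1) (\<beta> + real d) = Beta (\<alpha> + real j) (\<beta> + real (Suc d))"
      using Beta_real_plus1_plus1[OF pos] by (simp add: ac_simps)
    finally show ?case .
  qed
  then show "beta_weights \<alpha> \<beta>"
    unfolding beta_weights_def by (metis le_add_diff_inverse)
qed (simp add: beta_weights_def)

end

context nondeterministic_binary
begin

lemma polya_sequence_iff:
  "polya_sequence M X \<longleftrightarrow> (\<exists>\<alpha> \<beta>. 0 < \<alpha> \<and> 0 < \<beta> \<and> beta_weights \<alpha> \<beta>)"
proof -
  have "de_finetti_measure M X = density (restrict_space lborel {0..1})
          (\<lambda>\<theta>. ennreal (1 / Beta \<alpha> \<beta> * \<theta> powr (\<alpha> - 1) * (1 - \<theta>) powr (\<beta> - 1))) \<longleftrightarrow> beta_weights \<alpha> \<beta>"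
    (is "_ = ?\<gamma> \<longleftrightarrow> _") if ab: "0 < \<alpha>" "0 < \<beta>" for \<alpha> \<beta>
  proof -
    have "de_finetti_measure M X = ?\<gamma> \<longleftrightarrow> is_de_finetti_measure M X ?\<gamma>"
    proof
      assume "de_finetti_measure M X = ?\<gamma>"
      with de_finetti show "is_de_finetti_measure M X ?\<gamma>" by (simp only:)
    qed (rule de_finetti_measure_eqI)
    also have "\<dots> \<longleftrightarrow> beta_weights \<alpha> \<beta>"
      unfolding is_de_finetti_measure_iff beta_weights_iff_moments[OF ab]
      using Beta_density_moments[OF ab] by auto
    finally show ?thesis .
  qed
  then show ?thesis unfolding polya_sequence_def by blast
qed

theorem hoeffding_decomposable_iff_iid_or_polya:
  "hoeffding_decomposable M X \<longleftrightarrow> iid_sequence M X \<or> polya_sequence M X"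
  using hoeffding_decomposable_iff affine_prediction_iff iid_sequence_imp_weights
    iid_weights_imp_sequence polya_sequence_iff by blast

end

theorem theorem1:
  fixes M :: "'a measure" and X :: "nat \<Rightarrow> 'a \<Rightarrow> nat"
  assumes "prob_space M"
    and "\<And>n. n \<ge> 1 \<Longrightarrow> X n \<in> measurable M bin"
    and "sets M = sets (generated_algebra M X {1..})"
    and "exchangeable M X"
    and "non_deterministic M X"
  shows "hoeffding_decomposable M X \<longleftrightarrow> iid_sequence M X \<or> polya_sequence M X"
proof -
  interpret prob_space M by fact
  interpret nondeterministic_binary M X
    by unfold_locales (use assms in auto)
  show ?thesis by (rule hoeffding_decomposable_iff_iid_or_polya)
qed

end
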